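(* Let $N\ge2$, let $(\alpha,\beta,\gamma)$ be a permutation of $(x,y,z)$, and let $n_t>N/2$ be an integer. Consider any circuit on $N$ spins consisting of $2n_t$ layers of $\mathrm{TF}\alpha\beta$ gates, in time order alternately odd layers and even layers, beginning with an odd layer. Then the operator of this circuit is equal to the operator of a square circuit on $N$ spins of $\mathrm{TF}\alpha\beta$ gates (hence $N(N-1)/2$ such gates in $N$ layers, independent of $n_t$), and also to the operator of a triangle circuit on $N$ spins of $\mathrm{TF}\alpha\beta$ gates.
   Context: $\sigma^x,\sigma^y,\sigma^z$ are the Pauli matrices, and $\sigma_i^\alpha=I^{\otimes(i-1)}\otimes\sigma^\alpha\otimes I^{\otimes(N-i)}$ on $(\mathbb C^2)^{\otimes N}$. $R_i^\alpha(\theta)=\exp(-\mathrm{i}\,\sigma_i^\alpha\,\theta/2)$ and $R_i^{\alpha\alpha}(\theta)=\exp(-\mathrm{i}\,\sigma_i^\alpha\sigma_{i+1}^\alpha\,\theta/2)$. A $\mathrm{TF}\alpha\beta$ gate at position $i\in\{1,\dots,N-1\}$ is any operator of the form $$R_i^\gamma(\theta_5)R_{i+1}^\gamma(\theta_6)\,R_i^{\alpha\alpha}(\theta_3)R_i^{\beta\beta}(\theta_4)\,R_i^\gamma(\theta_1)R_{i+1}^\gamma(\theta_2),\qquad \theta_1,\dots,\theta_6\in\mathbb R.$$ (These are the gates for the transverse-field Hamiltonians $H(t)=\sum_{i=1}^{N-1}(J_i^\alpha(t)\sigma_i^\alpha\sigma_{i+1}^\alpha+J_i^\beta(t)\sigma_i^\beta\sigma_{i+1}^\beta)+\sum_{i=1}^N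 h_i^\gamma(t)\sigma_i^\gamma$.) A circuit is a time-ordered sequence of gates $g_1,\dots,g_m$ (first to last) with operator $g_m\cdots g_1$. An odd (even) layer consists of one gate at each odd (even) position in $\{1,\dots,N-1\}$. A square circuit on $N$ spins consists of $N$ layers, in time order alternately odd and even, the first being odd. A triangle circuit on $N$ spins consists, in time order, of $N-1$ descending cascades, the $k$-th containing $k$ gates at positions $N-k,N-k+1,\dots,N-1$ in this time order. *)

theory Defs
  imports "Jordan_Normal_Form.Matrix" Complex_Main
begin

datatype axis = SX | SY | SZ

fun pauli :: "axis \<Rightarrow> complex mat" where
  "pauli SX = mat_of_rows_list 2 [[0, 1], [1, 0]]"
| "pauli SY = mat_of_rows_list 2 [[0, - \<i>], [\<i>, 0]]"
| "pauli SZ = mat_of_rows_list 2 [[1, 0], [0, - 1]]"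

text \<open>Kronecker product: the operator tensor product in the lexicographically ordered
  product basis.\<close>

definition kron :: "complex mat \<Rightarrow> complex mat \<Rightarrow> complex mat" where
  "kron A B = mat (dim_row A * dim_row B) (dim_col A * dim_col B)
     (\<lambda>(i, j). A $$ (i div dim_row B, j div dim_col B) * B $$ (i mod dim_row B, j mod dim_col B))"

definition tensor_list :: "complex mat list \<Rightarrow> complex mat" where
  "tensor_list As = foldr kron As (1\<^sub>m 1)"

text \<open>The exponential series is taken entrywise; for a square matrix each of these series
  converges absolutely.\<close>

definition mat_exp :: "complex mat \<Rightarrow> complex mat" where
  "mat_exp A = mat (dim_row A) (dim_row A) (\<lambda>ij. \<Sum>k. (1 / fact k) * (A ^\<^sub>m k) $$ ij)"

text \<open>Sites are numbered from 1 to \<open>N\<close>, and operators on the \<open>N\<close>-spin space are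
  \<open>2 ^ N\<close>-dimensional square matrices.\<close>

definition site_pauli :: "nat \<Rightarrow> axis \<Rightarrow> nat \<Rightarrow> complex mat" where
  "site_pauli N a i =
     tensor_list (replicate (i - 1) (1\<^sub>m 2) @ [pauli a] @ replicate (N - i) (1\<^sub>m 2))"

definition rot :: "nat \<Rightarrow> axis \<Rightarrow> nat \<Rightarrow> real \<Rightarrow> complex mat" where
  "rot N a i \<theta> = mat_exp ((- \<i> * complex_of_real \<theta> / 2) \<cdot>\<^sub>m site_pauli N a i)"

definition rot2 :: "nat \<Rightarrow> axis \<Rightarrow> nat \<Rightarrow> real \<Rightarrow> complex mat" where
  "rot2 N a i \<theta> =
     mat_exp ((- \<i> * complex_of_real \<theta> / 2) \<cdot>\<^sub>m (site_pauli N a i * site_pauli N a (i + 1)))"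

definition is_TF_gate :: "nat \<Rightarrow> axis \<Rightarrow> axis \<Rightarrow> axis \<Rightarrow> nat \<Rightarrow> complex mat \<Rightarrow> bool" where
  "is_TF_gate N \<alpha> \<beta> \<gamma> i U \<longleftrightarrow> i \<in> {1..N - 1} \<and>
     (\<exists>\<theta>1 \<theta>2 \<theta>3 \<theta>4 \<theta>5 \<theta>6 :: real.
        U = rot N \<gamma> i \<theta>5 * rot N \<gamma> (i + 1) \<theta>6 *
            rot2 N \<alpha> i \<theta>3 * rot2 N \<beta> i \<theta>4 *
            rot N \<gamma> i \<theta>1 * rot N \<gamma> (i + 1) \<theta>2)"

text \<open>A circuit is a list of (position, operator) pairs, the first gate in time being the head
  of the list; hence later gates multiply from the left.\<close>

type_synonym circuit = "(nat \<times> complex mat) list"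

definition is_TF_circuit :: "nat \<Rightarrow> axis \<Rightarrow> axis \<Rightarrow> axis \<Rightarrow> circuit \<Rightarrow> bool" where
  "is_TF_circuit N \<alpha> \<beta> \<gamma> gs \<longleftrightarrow> (\<forall>(i, U) \<in> set gs. is_TF_gate N \<alpha> \<beta> \<gamma> i U)"

definition circuit_op :: "nat \<Rightarrow> circuit \<Rightarrow> complex mat" where
  "circuit_op N gs = foldl (\<lambda>V (i, U). U * V) (1\<^sub>m (2 ^ N)) gs"

text \<open>The parity \<open>P\<close> is \<open>odd\<close> or \<open>even\<close>. The time order of the gates inside a layer is
  left arbitrary.\<close>

definition is_TF_layer ::
  "nat \<Rightarrow> axis \<Rightarrow> axis \<Rightarrow> axis \<Rightarrow> (nat \<Rightarrow> bool) \<Rightarrow> circuit \<Rightarrow> bool" where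
  "is_TF_layer N \<alpha> \<beta> \<gamma> P gs \<longleftrightarrow> is_TF_circuit N \<alpha> \<beta> \<gamma> gs \<and>
     distinct (map fst gs) \<and> set (map fst gs) = {i \<in> {1..N - 1}. P i}"

text \<open>List indices start at 0, so the even indices carry the odd layers. The circuit described
  by a list of layers is its concatenation.\<close>

definition is_TF_brickwork ::
  "nat \<Rightarrow> axis \<Rightarrow> axis \<Rightarrow> axis \<Rightarrow> nat \<Rightarrow> circuit list \<Rightarrow> bool" where
  "is_TF_brickwork N \<alpha> \<beta> \<gamma> m Ls \<longleftrightarrow> length Ls = m \<and>
     (\<forall>k<m. is_TF_layer N \<alpha> \<beta> \<gamma> (if even k then odd else even) (Ls ! k))"

definition is_TF_square :: "nat \<Rightarrow> axis \<Rightarrow> axis \<Rightarrow> axis \<Rightarrow> circuit list \<Rightarrow> bool" where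
  "is_TF_square N \<alpha> \<beta> \<gamma> Ls \<longleftrightarrow> is_TF_brickwork N \<alpha> \<beta> \<gamma> N Ls"

definition is_TF_triangle :: "nat \<Rightarrow> axis \<Rightarrow> axis \<Rightarrow> axis \<Rightarrow> circuit \<Rightarrow> bool" where
  "is_TF_triangle N \<alpha> \<beta> \<gamma> gs \<longleftrightarrow> is_TF_circuit N \<alpha> \<beta> \<gamma> gs \<and>
     map fst gs = concat (map (\<lambda>k. [N - k..<N]) [1..<N])"

end

theory Submission
  imports Defs
begin

text \<open>
  Under the Jordan-Wigner transformation the operators \<open>\<gamma>\<close> at site \<open>i\<close> and \<open>\<alpha>\<alpha>\<close> at the sites \<open>i, i + 1\<close>
  become the products of neighbouring Majorana operators \<open>2i - 1, 2i\<close> and \<open>2i, 2i + 1\<close>, and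
  \<open>\<beta>\<beta>\<close> is minus the product of two \<open>\<gamma>\<close> and \<open>\<alpha>\<alpha>\<close>. Neighbouring products anticommute and distant ones
  commute, so by the Euler angles of \<open>SU(2)\<close> the sets of rotations they generate satisfy the relations
  of the 0-Hecke monoid of the symmetric group on \<open>2N\<close> strands. The \<open>TF\<close> gates at \<open>i\<close> form the
  group \<open>Spin(4) = SU(2) \<times> SU(2)\<close>, which is the set belonging to the longest element on the strands
  \<open>2i - 1, \<dots>, 2i + 2\<close>. Hence the \<open>TF\<close> gates satisfy the 0-Hecke relations on \<open>N\<close> strands; the braid
  relation (turnover) holds because both of its sides are words for the longest element on six strands.
  In a 0-Hecke monoid the triangle word absorbs every letter, so it bounds every word, and pushing
  cascades through each other along the diagonals of the square shows that the square word bounds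
  the triangle word.
\<close>

section \<open>Words in a 0-Hecke monoid\<close>

text \<open>The relations of the 0-Hecke monoid of the symmetric group on \<open>n\<close> strands, as a preorder: a word
  stands for the set of operators of circuits with gates at these positions, \<open>\<lesssim>\<close> for inclusion.\<close>

locale hecke_order =
  fixes le :: "nat list \<Rightarrow> nat list \<Rightarrow> bool" (infix "\<lesssim>" 50) and n :: nat
  assumes le_refl: "w \<lesssim> w"
    and le_trans [trans]: "u \<lesssim> v \<Longrightarrow> v \<lesssim> w \<Longrightarrow> u \<lesssim> w"
    and le_cong: "v \<lesssim> w \<Longrightarrow> x @ v @ y \<lesssim> x @ w @ y"
    and le_unit: "i \<in> {1..<n} \<Longrightarrow> [] \<lesssim> [i]"
    and le_idem: "i \<in> {1..<n} \<Longrightarrow> [i, i] \<lesssim> [i]"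
    and le_comm: "i \<in> {1..<n} \<Longrightarrow> j \<in> {1..<n} \<Longrightarrow> i + 1 < j \<or> j + 1 < i \<Longrightarrow> [i, j] \<lesssim> [j, i]"
    and le_braid: "i \<in> {1..<n} \<Longrightarrow> j \<in> {1..<n} \<Longrightarrow> j = i + 1 \<or> i = j + 1 \<Longrightarrow>
      [i, j, i] \<lesssim> [j, i, j]"
begin

lemma le_append: "v \<lesssim> v' \<Longrightarrow> w \<lesssim> w' \<Longrightarrow> v @ w \<lesssim> v' @ w'"
  using le_trans[of "v @ w" "v' @ w" "v' @ w'"] le_cong[of v v' "[]" w] le_cong[of w w' v' "[]"]
  by simp

lemma le_append_left: "v \<lesssim> w \<Longrightarrow> x @ v \<lesssim> x @ w"
  using le_cong[of v w x "[]"] by simp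

lemma le_append_right: "v \<lesssim> w \<Longrightarrow> v @ y \<lesssim> w @ y"
  using le_cong[of v w "[]" y] by simp

text \<open>Two nested inductions: each letter of \<open>v\<close> in turn travels through all of
  \<open>w\<close>.\<close>

lemma le_comm_words:
  assumes "set v \<subseteq> {1..<n}" "set w \<subseteq> {1..<n}"
    and "\<And>i j. i \<in> set v \<Longrightarrow> j \<in> set w \<Longrightarrow> i + 1 < j \<or> j + 1 < i"
  shows "v @ w \<lesssim> w @ v"
  using assms
proof (induction v)
  case Nil
  show ?case by (simp add: le_refl)
next
  case (Cons i v)
  note prems = Cons.prems
  have single: "[i] @ u \<lesssim> u @ [i]" if "set u \<subseteq> set w" for u
    using that
  proof (induction u)
    case Nil
    show ?case by (simp add: le_refl)
  next
    case (Cons j u)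
    have "[i, j] \<lesssim> [j, i]"
      using Cons.prems prems(1,2) prems(3)[of i j] by (intro le_comm) auto
    then have "[i, j] @ u \<lesssim> [j, i] @ u" by (rule le_append_right)
    also have "[j, i] @ u \<lesssim> [j] @ u @ [i]" using Cons le_append_left[of "[i] @ u" _ "[j]"] by simp
    finally show ?case by simp
  qed
  have "[i] @ v @ w \<lesssim> [i] @ w @ v" using Cons by (intro le_append_right le_append_left) auto
  also have "[i] @ w @ v \<lesssim> (w @ [i]) @ v"
    using le_append[OF single le_refl, of w v] by simp
  finally show ?case by simp
qed

lemma cascade_split: "a \<le> i \<Longrightarrow> i + 1 < b \<Longrightarrow> [a..<b] = [a..<i] @ [i, i + 1] @ [i + 2..<b]"
  by (metis (no_types, lifting) Suc_eq_plus1 add_2_eq_Suc' append_Cons append_Nil less_imp_le_nat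
      less_trans upt_add_eq_append[of a i "b - i"] le_add_diff_inverse upt_conv_Cons lessI less_Suc_eq)

text \<open>The letter \<open>i\<close> slides left past the letters from \<open>i + 2\<close> on,
  becomes \<open>i + 1\<close> in a braid relation with \<open>i, i + 1\<close>, and slides on past
  the letters below \<open>i\<close>. All these relations are reversible.\<close>

lemma cascade_shift:
  assumes "1 \<le> a" "a \<le> i" "i + 1 < b" "b \<le> n"
  shows "[a..<b] @ [i] \<lesssim> [i + 1] @ [a..<b]" and "[i + 1] @ [a..<b] \<lesssim> [a..<b] @ [i]"
proof -
  note split = cascade_split[OF assms(2,3)]
  have 1: "[i + 2..<b] @ [i] \<lesssim> [i] @ [i + 2..<b]" "[i] @ [i + 2..<b] \<lesssim> [i + 2..<b] @ [i]"
    and 2: "[a..<i] @ [i + 1] \<lesssim> [i + 1] @ [a..<i]" "[i + 1] @ [a..<i] \<lesssim> [a..<i] @ [i + 1]"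
    using assms by (intro le_comm_words; auto)+
  have 3: "[i, i + 1, i] \<lesssim> [i + 1, i, i + 1]" "[i + 1, i, i + 1] \<lesssim> [i, i + 1, i]"
    using assms by (intro le_braid; simp)+
  have "[a..<i] @ [i, i + 1] @ [i + 2..<b] @ [i] \<lesssim> [a..<i] @ [i, i + 1] @ [i] @ [i + 2..<b]"
    by (intro le_append_left 1)
  also have "\<dots> \<lesssim> [a..<i] @ [i + 1, i, i + 1] @ [i + 2..<b]"
    using le_cong[OF 3(1)] by simp
  also have "\<dots> \<lesssim> ([i + 1] @ [a..<i]) @ [i, i + 1] @ [i + 2..<b]"
    using le_append[OF 2(1) le_refl, of "[i, i + 1] @ [i + 2..<b]"] by simp
  finally show "[a..<b] @ [i] \<lesssim> [i + 1] @ [a..<b]" unfolding split by simp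
  have "[i + 1] @ [a..<i] @ [i, i + 1] @ [i + 2..<b] \<lesssim> [a..<i] @ [i + 1, i, i + 1] @ [i + 2..<b]"
    using le_append[OF 2(2) le_refl, of "[i, i + 1] @ [i + 2..<b]"] by simp
  also have "\<dots> \<lesssim> [a..<i] @ [i, i + 1] @ [i] @ [i + 2..<b]"
    using le_cong[OF 3(2)] by simp
  also have "\<dots> \<lesssim> [a..<i] @ [i, i + 1] @ [i + 2..<b] @ [i]"
    by (intro le_append_left 1)
  finally show "[i + 1] @ [a..<b] \<lesssim> [a..<b] @ [i]" unfolding split by simp
qed

section \<open>Cascades and the triangle word\<close>

text \<open>For \<open>m \<le> n\<close> a reduced word for the longest permutation of the last
  \<open>m\<close> strands; \<open>cascades n\<close> is the triangle word, and \<open>m\<close>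
  serves the induction.\<close>

definition cascades :: "nat \<Rightarrow> nat list" where
  "cascades m = concat (map (\<lambda>k. [n - k..<n]) [1..<m])"

lemma cascades_Suc: "1 \<le> m \<Longrightarrow> cascades (Suc m) = cascades m @ [n - m..<n]"
  by (simp add: cascades_def)

text \<open>The letter \<open>n - 1\<close> fuses with the end of the last cascade. Any other letter
  crosses the last cascade as \<open>i + 1\<close> and is absorbed by the smaller triangle in
  front.\<close>

lemma cascades_absorb:
  assumes "m \<le> n" "n < m + i" "i < n"
  shows "cascades m @ [i] \<lesssim> cascades m"
  using assms
proof (induction m arbitrary: i)
  case (Suc m)
  have m: "1 \<le> m" using Suc.prems by simp
  show ?case
  proof (cases "i = n - 1")
    case True
    have split: "[n - m..<n] = [n - m..<n - 1] @ [n - 1]"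
      using m Suc.prems upt_Suc_append[of "n - m" "n - 1"] by simp
    have "[n - 1, n - 1] \<lesssim> [n - 1]" using m Suc.prems by (intro le_idem) simp
    then have "(cascades m @ [n - m..<n - 1]) @ [n - 1, n - 1]
        \<lesssim> (cascades m @ [n - m..<n - 1]) @ [n - 1]"
      by (intro le_append_right le_append_left)
    then show ?thesis using True by (simp add: cascades_Suc[OF m] split)
  next
    case False
    have "[n - m..<n] @ [i] \<lesssim> [i + 1] @ [n - m..<n]"
      using False Suc.prems m by (intro cascade_shift) auto
    then have "cascades m @ [n - m..<n] @ [i] \<lesssim> cascades m @ [i + 1] @ [n - m..<n]"
      by (intro le_append_left) (simp add: le_append_left)
    also have "\<dots> \<lesssim> cascades m @ [n - m..<n]"
      using le_append[OF Suc.IH le_refl, of "i + 1" "[n - m..<n]"] False Suc.prems by simp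
    finally show ?thesis by (simp add: cascades_Suc[OF m])
  qed
qed simp

text \<open>Units insert the whole triangle word in front of \<open>w\<close>; the triangle then
  absorbs \<open>w\<close> letter by letter.\<close>

lemma le_triangle:
  assumes "set w \<subseteq> {1..<n}"
  shows "w \<lesssim> cascades n"
proof -
  have nil: "[] \<lesssim> u" if "set u \<subseteq> {1..<n}" for u
    using that
  proof (induction u)
    case (Cons i u)
    then show ?case using le_append[OF le_unit[of i], of "[]" u] by simp
  qed (simp add: le_refl)
  have absorb: "cascades n @ v \<lesssim> cascades n" if "set v \<subseteq> {1..<n}" for v
    using that
  proof (induction v)
    case (Cons i v)
    have "(cascades n @ [i]) @ v \<lesssim> cascades n @ v"
      using Cons.prems by (intro le_append_right cascades_absorb) auto
    also have "\<dots> \<lesssim> cascades n" using Cons by simp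
    finally show ?case by simp
  qed (simp add: le_refl)
  have "set (cascades n) \<subseteq> {1..<n}" by (auto simp: cascades_def)
  then have "[] @ w \<lesssim> cascades n @ w" by (intro le_append_right nil)
  also have "\<dots> \<lesssim> cascades n" using assms by (rule absorb)
  finally show ?thesis by simp
qed

section \<open>From the triangle to the diagonals of the square\<close>

text \<open>Iterates \<open>cascade_shift\<close>: the letter nearest to the cascade crosses first,
  and each letter drops by one.\<close>

lemma cascade_pass:
  assumes "1 \<le> a" "a \<le> x" "y < n"
  shows "[Suc x..<Suc y] @ [a..<n] \<lesssim> [a..<n] @ [x..<y]"
  using assms(3)
proof (induction y)
  case (Suc y)
  show ?case
  proof (cases "x \<le> y")
    case True
    have "[Suc x..<Suc y] @ [y + 1] @ [a..<n] \<lesssim> [Suc x..<Suc y] @ [a..<n] @ [y]"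
      using Suc.prems assms True by (intro le_append_left cascade_shift) auto
    also have "\<dots> \<lesssim> ([a..<n] @ [x..<y]) @ [y]"
      using le_append[OF Suc.IH le_refl, of "[y]"] Suc.prems by simp
    finally show ?thesis using True by simp
  qed (simp add: le_refl)
qed (simp add: le_refl)

text \<open>Crossing \<open>m\<close> cascades lowers the letters \<open>m\<close> times.\<close>

lemma cascades_pass:
  assumes "1 \<le> x" "m + y \<le> n"
  shows "[m + x..<m + y] @ concat (map (\<lambda>a. [a..<n]) (rev [1..<m + 1]))
    \<lesssim> concat (map (\<lambda>a. [a..<n]) (rev [1..<m + 1])) @ [x..<y]"
  using assms(2)
proof (induction m)
  case (Suc m)
  let ?C = "concat (map (\<lambda>a. [a..<n]) (rev [1..<m + 1]))"
  have "[Suc (m + x)..<Suc (m + y)] @ [m + 1..<n] \<lesssim> [m + 1..<n] @ [m + x..<m + y]"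
    using assms Suc.prems by (intro cascade_pass) auto
  then have "([Suc (m + x)..<Suc (m + y)] @ [m + 1..<n]) @ ?C
      \<lesssim> ([m + 1..<n] @ [m + x..<m + y]) @ ?C"
    by (rule le_append_right)
  also have "\<dots> \<lesssim> [m + 1..<n] @ ?C @ [x..<y]"
    using le_append_left[OF Suc.IH, of "[m + 1..<n]"] Suc.prems by simp
  finally show ?case by simp
qed (simp add: le_refl)

text \<open>The cascades start at \<open>n - 1\<close> down to 1. Starting points from
  \<open>n\<close> on only add empty cascades; running up to \<open>2 * n\<close> makes their number
  even, which fits the induction by pairs in \<open>cascades_le_diagonals\<close>.\<close>

lemma cascades_conv: "cascades n = concat (map (\<lambda>a. [a..<n]) (rev [1..<2 * n + 1]))"
proof -
  have "rev [1..<n] = map (\<lambda>k. n - k) [1..<n]"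
    by (intro nth_equalityI) (auto simp: rev_nth)
  then have 1: "cascades n = concat (map (\<lambda>a. [a..<n]) (rev [1..<n]))"
    by (simp add: cascades_def comp_def)
  show ?thesis
  proof (cases "n = 0")
    case False
    then have "[1..<2 * n + 1] = [1..<n] @ [n..<2 * n + 1]"
      using upt_add_eq_append[of 1 n "n + 1"] by (simp del: upt_Suc add: mult_2)
    moreover have "concat (map (\<lambda>a. [a..<n]) (rev [n..<2 * n + 1])) = []"
      by (simp del: upt_Suc)
    ultimately show ?thesis unfolding 1 by (simp del: upt_Suc)
  qed (use 1 in simp)
qed

text \<open>The cascade starting at \<open>2 * j + 2\<close> crosses the \<open>2 * j + 1\<close>
  cascades after it and becomes an interval starting at 1. Cascades with odd start thus stay in
  front, those with even start go to the back, and together they are the diagonals of the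
  square.\<close>

lemma cascades_le_diagonals:
  "concat (map (\<lambda>a. [a..<n]) (rev [1..<2 * j + 1]))
    \<lesssim> concat (map (\<lambda>a. [a..<n]) (rev (filter odd [1..<2 * j + 1]))) @
      concat (map (\<lambda>b. [1..<n + 1 - 2 * b]) [1..<j + 1])"
proof (induction j)
  case (Suc j)
  let ?F = "\<lambda>m. concat (map (\<lambda>a. [a..<n]) (rev [1..<m + 1]))"
  let ?P = "concat (map (\<lambda>a. [a..<n]) (rev (filter odd [1..<2 * j + 1])))"
  let ?Q = "concat (map (\<lambda>b. [1..<n + 1 - 2 * b]) [1..<j + 1])"
  let ?D = "[2 * j + 1..<n]" and ?E = "[1..<n + 1 - 2 * (j + 1)]"
  have "[2 * j + 2..<n] @ ?F (2 * j + 1) \<lesssim> ?F (2 * j + 1) @ ?E"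
  \<comment> \<open>Otherwise both the moving cascade and \<open>?E\<close> are empty.\<close>
  proof (cases "2 * j + 1 \<le> n")
    case True
    then show ?thesis
      using cascades_pass[of 1 "2 * j + 1" "n - (2 * j + 1)"] by simp
  qed (simp add: le_refl)
  also have "?F (2 * j + 1) @ ?E = ?D @ ?F (2 * j) @ ?E" by simp
  also have "\<dots> \<lesssim> ?D @ (?P @ ?Q) @ ?E"
    by (intro le_append_left le_append_right Suc.IH)
  finally show ?case by simp
qed (simp add: le_refl)

section \<open>Reordering commuting letters; the square word\<close>

text \<open>Only pairs listed in opposite orders have to be exchanged, and their labels commute. The
  induction brings the head of \<open>xs\<close> to the front of \<open>ys\<close>: whatever
  precedes it there follows it in \<open>xs\<close>.\<close>

lemma le_reorder:
  fixes lab :: "'p \<Rightarrow> nat"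
  assumes "sorted_wrt R xs" "sorted_wrt Q ys" "set xs = set ys" "distinct xs" "distinct ys"
    and "\<And>x y. x \<in> set xs \<Longrightarrow> y \<in> set xs \<Longrightarrow> R x y \<Longrightarrow> Q y x \<Longrightarrow>
      lab x + 1 < lab y \<or> lab y + 1 < lab x"
    and "lab ` set xs \<subseteq> {1..<n}"
  shows "map lab ys \<lesssim> map lab xs"
  using assms
proof (induction xs arbitrary: ys)
  case (Cons x xs)
  then obtain ys1 ys2 where ys: "ys = ys1 @ x # ys2" by (metis list.set_intros(1) split_list)
  have set_xs: "set xs = set (ys1 @ ys2)" using Cons.prems(3-5) unfolding ys by auto
  have "map lab ys1 @ [lab x] \<lesssim> [lab x] @ map lab ys1"
  proof (rule le_comm_words)
    fix i j assume "i \<in> set (map lab ys1)" "j \<in> set [lab x]"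
    then obtain y where y: "y \<in> set ys1" "i = lab y" "j = lab x" by auto
    have "R x y" "Q y x" using Cons.prems(1,2) y set_xs unfolding ys by (auto simp: sorted_wrt_append)
    then show "i + 1 < j \<or> j + 1 < i" using Cons.prems(6)[of x y] y set_xs by auto
  qed (use Cons.prems(7) set_xs in auto)
  then have "(map lab ys1 @ [lab x]) @ map lab ys2 \<lesssim> ([lab x] @ map lab ys1) @ map lab ys2"
    by (rule le_append_right)
  also have "\<dots> = [lab x] @ map lab (ys1 @ ys2)" by simp
  also have "\<dots> \<lesssim> [lab x] @ map lab xs"
  proof (intro le_append_left Cons.IH)
    show "sorted_wrt Q (ys1 @ ys2)" using Cons.prems(2) unfolding ys by (auto simp: sorted_wrt_append)
  qed (use Cons.prems set_xs ys in auto)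
  finally show ?case unfolding ys by simp
qed (simp add: le_refl)

end

lemma sorted_wrt_concatI:
  assumes "\<And>xs. xs \<in> set xss \<Longrightarrow> sorted_wrt R xs"
    and "sorted_wrt (\<lambda>xs ys. \<forall>x\<in>set xs. \<forall>y\<in>set ys. R x y) xss"
  shows "sorted_wrt R (concat xss)"
  using assms by (induction xss) (auto simp: sorted_wrt_append)

lemma sorted_wrt_irrefl_distinct: "sorted_wrt R xs \<Longrightarrow> (\<And>x. \<not> R x x) \<Longrightarrow> distinct xs"
  by (induction xs) auto

text \<open>Layers are counted from 0, so \<open>odd (i + k)\<close> puts the odd positions into
  layer 0.\<close>

definition brick_word :: "nat \<Rightarrow> nat \<Rightarrow> nat list" where
  "brick_word n m = concat (map (\<lambda>k. filter (\<lambda>i. odd (i + k)) [1..<n]) [0..<m])"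

text \<open>A reduced word for the longest permutation of the strands \<open>2 * i - 1\<close> to \<open>2 * i + 2\<close>.\<close>

definition block :: "nat \<Rightarrow> nat list" where
  "block i = map (\<lambda>j. j + 2 * i - 2) [3, 2, 3, 1, 2, 3]"

lemma set_block: "1 \<le> i \<Longrightarrow> set (block i) = {2 * i - 1..2 * i + 1}"
  by (auto simp: block_def)

context hecke_order
begin

text \<open>The gate at position \<open>i\<close> in layer \<open>k\<close> is the pair \<open>(k, i)\<close>. Listing the brickwork by the
  diagonals of constant \<open>k - i\<close> instead of by layers only exchanges commuting letters.\<close>

lemma triangle_le_brick_word: "cascades n \<lesssim> brick_word n n"
proof -
  note upt_Suc [simp del]
  define xs where "xs = concat (map (\<lambda>k. map (Pair k) (filter (\<lambda>i. odd (i + k)) [1..<n])) [0..<n])"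
  \<comment> \<open>\<open>P\<close> runs through the diagonals \<open>i - k = a\<close> with
    \<open>a\<close> odd, hence \<open>k < i\<close>; \<open>Q\<close> through the diagonals
    \<open>k - i = 2 * b - 1\<close>, hence \<open>i < k\<close>.\<close>
  define P where "P = concat (map (\<lambda>a. map (\<lambda>i. (i - a, i)) [a..<n]) (rev (filter odd [1..<2 * n + 1])))"
  define Q where "Q = concat (map (\<lambda>b. map (\<lambda>i. (i + 2 * b - 1, i)) [1..<n + 1 - 2 * b]) [1..<n + 1])"
  define R1 where "R1 = (\<lambda>(k, i) (k', i'). (k :: nat) < k' \<or> k = k' \<and> (i :: nat) < i')"
  \<comment> \<open>Orders by \<open>k - i\<close> and then by \<open>k\<close>; sums replace the
    differences, because subtraction of naturals truncates.\<close>
  define R2 where "R2 = (\<lambda>(k, i) (k', i'). k + i' < k' + i \<or> k + i' = k' + i \<and> (k :: nat) < k')"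
  have xs: "map snd xs = brick_word n n"
    by (simp add: xs_def brick_word_def map_concat comp_def)
  have ys: "map snd (P @ Q) = concat (map (\<lambda>a. [a..<n]) (rev (filter odd [1..<2 * n + 1]))) @
      concat (map (\<lambda>b. [1..<n + 1 - 2 * b]) [1..<n + 1])"
    by (simp add: P_def Q_def map_concat comp_def)
  have set_xs: "set xs = {(k, i). k < n \<and> 1 \<le> i \<and> i < n \<and> odd (i + k)}"
    by (auto simp: xs_def)
  have set_P: "set P = {(k, i). k < n \<and> 1 \<le> i \<and> i < n \<and> odd (i + k) \<and> k < i}"
  proof (intro equalityI subsetI)
    fix p assume "p \<in> {(k, i). k < n \<and> 1 \<le> i \<and> i < n \<and> odd (i + k) \<and> k < i}"
    then obtain k i where p: "p = (k, i)" "1 \<le> i" "i < n" "odd (i + k)" "k < i" by auto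
    define a where "a = i - k"
    have a: "k = i - a" "1 \<le> a" "a \<le> i" using p(5) by (simp_all add: a_def)
    have "odd a" using p(4,5) unfolding a_def by presburger
    then have "a \<in> set (rev (filter odd [1..<2 * n + 1]))" using a p(3) by simp
    moreover have "p \<in> set (map (\<lambda>i. (i - a, i)) [a..<n])" using a p(1,3) by simp
    ultimately show "p \<in> set P" unfolding P_def by fastforce
  next
    fix p assume "p \<in> set P"
    then obtain a i where "p = (i - a, i)" "odd a" "1 \<le> a" "a \<le> i" "i < n"
      unfolding P_def by auto
    then show "p \<in> {(k, i). k < n \<and> 1 \<le> i \<and> i < n \<and> odd (i + k) \<and> k < i}" by auto
  qed
  have set_Q: "set Q = {(k, i). k < n \<and> 1 \<le> i \<and> i < n \<and> odd (i + k) \<and> i \<le> k}"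
  proof (intro equalityI subsetI)
    fix p assume "p \<in> {(k, i). k < n \<and> 1 \<le> i \<and> i < n \<and> odd (i + k) \<and> i \<le> k}"
    then obtain k i where p: "p = (k, i)" "1 \<le> i" "i < n" "k < n" "odd (i + k)" "i \<le> k" by auto
    define b where "b = (k - i + 1) div 2"
    have b: "2 * b = k - i + 1" using p unfolding b_def by presburger
    have "b \<in> set [1..<n + 1]" using p b by simp
    moreover have "k = i + 2 * b - 1" "i < n + 1 - 2 * b" using p(4,6) b by simp_all
    then have "p \<in> set (map (\<lambda>i. (i + 2 * b - 1, i)) [1..<n + 1 - 2 * b])" using p(1,2) by simp
    ultimately show "p \<in> set Q" unfolding Q_def by fastforce
  next
    fix p assume "p \<in> set Q"
    then obtain b i where "p = (i + 2 * b - 1, i)" "1 \<le> b" "1 \<le> i" "i < n + 1 - 2 * b"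
      unfolding Q_def by auto
    then show "p \<in> {(k, i). k < n \<and> 1 \<le> i \<and> i < n \<and> odd (i + k) \<and> i \<le> k}" by auto
  qed
  note upt = sorted_wrt_mono_rel[OF _ sorted_wrt_upt]
  have "sorted_wrt R1 xs"
    unfolding xs_def
  proof (rule sorted_wrt_concatI)
    show "sorted_wrt (\<lambda>xs ys. \<forall>x\<in>set xs. \<forall>y\<in>set ys. R1 x y)
        (map (\<lambda>k. map (Pair k) (filter (\<lambda>i. odd (i + k)) [1..<n])) [0..<n])"
      unfolding sorted_wrt_map by (rule upt) (auto simp: R1_def)
  next
    fix zs assume "zs \<in> set (map (\<lambda>k. map (Pair k) (filter (\<lambda>i. odd (i + k)) [1..<n])) [0..<n])"
    then obtain k where "zs = map (Pair k) (filter (\<lambda>i. odd (i + k)) [1..<n])" by auto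
    moreover have "sorted_wrt (\<lambda>i j. R1 (k, i) (k, j)) [1..<n]"
      by (rule upt) (auto simp: R1_def)
    ultimately show "sorted_wrt R1 zs" by (simp add: sorted_wrt_map sorted_wrt_filter)
  qed
  moreover have "sorted_wrt R2 (P @ Q)"
  proof -
    have "sorted_wrt R2 P"
      unfolding P_def
    proof (rule sorted_wrt_concatI)
      show "sorted_wrt (\<lambda>xs ys. \<forall>x\<in>set xs. \<forall>y\<in>set ys. R2 x y)
          (map (\<lambda>a. map (\<lambda>i. (i - a, i)) [a..<n]) (rev (filter odd [1..<2 * n + 1])))"
        unfolding sorted_wrt_map sorted_wrt_rev
        by (intro sorted_wrt_filter upt) (auto simp: R2_def)
    next
      fix zs assume "zs \<in> set (map (\<lambda>a. map (\<lambda>i. (i - a, i)) [a..<n])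
          (rev (filter odd [1..<2 * n + 1])))"
      then obtain a where "zs = map (\<lambda>i. (i - a, i)) [a..<n]" by auto
      moreover have "sorted_wrt (\<lambda>i j. R2 (i - a, i) (j - a, j)) [a..<n]"
        by (rule upt) (auto simp: R2_def)
      ultimately show "sorted_wrt R2 zs" by (simp add: sorted_wrt_map)
    qed
    moreover have "sorted_wrt R2 Q"
      unfolding Q_def
    proof (rule sorted_wrt_concatI)
      show "sorted_wrt (\<lambda>xs ys. \<forall>x\<in>set xs. \<forall>y\<in>set ys. R2 x y)
          (map (\<lambda>b. map (\<lambda>i. (i + 2 * b - 1, i)) [1..<n + 1 - 2 * b]) [1..<n + 1])"
        unfolding sorted_wrt_map by (rule upt) (auto simp: R2_def)
    next
      fix zs assume "zs \<in> set (map (\<lambda>b. map (\<lambda>i. (i + 2 * b - 1, i)) [1..<n + 1 - 2 * b]) [1..<n + 1])"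
      then obtain b where "zs = map (\<lambda>i. (i + 2 * b - 1, i)) [1..<n + 1 - 2 * b]"
        by auto
      moreover have "sorted_wrt (\<lambda>i j. R2 (i + 2 * b - 1, i) (j + 2 * b - 1, j)) [1..<n + 1 - 2 * b]"
        by (rule upt) (auto simp: R2_def)
      ultimately show "sorted_wrt R2 zs" by (simp add: sorted_wrt_map)
    qed
    ultimately show ?thesis
      by (auto simp: sorted_wrt_append set_P set_Q R2_def)
  qed
  moreover have "\<not> R1 p p" "\<not> R2 p p" for p by (auto simp: R1_def R2_def split: prod.splits)
  moreover have "set xs = set (P @ Q)" by (auto simp: set_xs set_P set_Q)
  moreover have "snd p + 1 < snd q \<or> snd q + 1 < snd p"
    if "p \<in> set xs" "q \<in> set xs" "R1 p q" "R2 q p" for p q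
  proof -
    obtain k i k' i' where pq: "p = (k, i)" "q = (k', i')" by (cases p, cases q)
    have "odd (i + k)" "odd (i' + k')" "k < k' \<or> k = k' \<and> i < i'"
      "k' + i < k + i' \<or> k' + i = k + i' \<and> k' < k"
      using that unfolding pq set_xs R1_def R2_def by auto
    \<comment> \<open>Within one layer, parity separates positions by at least 2. If
      \<open>k < k'\<close>, diagonals in the reverse order force \<open>i' - i > k' - k\<close>,
      again at least 2.\<close>
    then have "i + 1 < i' \<or> i' + 1 < i" by presburger
    then show ?thesis by (simp add: pq)
  qed
  moreover have "snd ` set xs \<subseteq> {1..<n}" by (auto simp: set_xs)
  ultimately have "map snd (P @ Q) \<lesssim> map snd xs"
    by (blast intro: le_reorder sorted_wrt_irrefl_distinct)
  then show ?thesis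
    using cascades_le_diagonals[of n] le_trans unfolding cascades_conv ys xs by blast
qed

section \<open>Blocks: two strands per spin\<close>

text \<open>A relabelling that keeps neighbours adjacent and distant letters distant pulls the
  relations back. Facts about few strands thus hold on any window of strands, read in either
  direction.\<close>

lemma hecke_order_reindex:
  assumes "\<And>i. i \<in> {1..<m} \<Longrightarrow> f i \<in> {1..<n}"
    and "\<And>i. i \<in> {1..<m} \<Longrightarrow> i + 1 \<in> {1..<m} \<Longrightarrow> f (i + 1) = f i + 1 \<or> f i = f (i + 1) + 1"
    and "\<And>i j. i \<in> {1..<m} \<Longrightarrow> j \<in> {1..<m} \<Longrightarrow> i + 1 < j \<Longrightarrow> f i + 1 < f j \<or> f j + 1 < f i"
  shows "hecke_order (\<lambda>v w. map f v \<lesssim> map f w) m"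
proof
  fix i j assume ij: "i \<in> {1..<m}" "j \<in> {1..<m}"
  show "map f [i, j] \<lesssim> map f [j, i]" if "i + 1 < j \<or> j + 1 < i"
    using that le_comm[OF assms(1,1), OF ij] assms(3)[OF ij] assms(3)[OF ij(2,1)] by auto
  show "map f [i, j, i] \<lesssim> map f [j, i, j]" if "j = i + 1 \<or> i = j + 1"
    using that le_braid[OF assms(1,1), OF ij] assms(2)[OF ij(1)] assms(2)[OF ij(2)] ij by auto
next
  fix u v w x y
  show "map f w \<lesssim> map f w" by (rule le_refl)
  show "map f u \<lesssim> map f v \<Longrightarrow> map f v \<lesssim> map f w \<Longrightarrow> map f u \<lesssim> map f w"
    by (rule le_trans)
  show "map f v \<lesssim> map f w \<Longrightarrow> map f (x @ v @ y) \<lesssim> map f (x @ w @ y)"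
    using le_cong by simp
next
  fix i assume "i \<in> {1..<m}"
  then have i: "f i \<in> {1..<n}" by (rule assms(1))
  show "map f [] \<lesssim> map f [i]" using le_unit[OF i] by simp
  show "map f [i, i] \<lesssim> map f [i]" using le_idem[OF i] by simp
qed

text \<open>The block is the shifted triangle word on four strands, so \<open>le_triangle\<close>
  applies to its window.\<close>

lemma le_block:
  assumes "1 \<le> i" "2 * i + 1 < n" "set w \<subseteq> {2 * i - 1..2 * i + 1}"
  shows "w \<lesssim> block i"
proof -
  let ?f = "\<lambda>j. j + 2 * i - 2"
  interpret sub: hecke_order "\<lambda>v w. map ?f v \<lesssim> map ?f w" 4
    using assms by (intro hecke_order_reindex) auto
  have w: "map ?f (map (\<lambda>j. j + 2 - 2 * i) w) = w"
    unfolding map_map using assms by (intro map_idI) fastforce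
  have "sub.cascades 4 = [3, 2, 3, 1, 2, 3]" by (simp add: sub.cascades_def upt_conv_Cons)
  moreover have "map ?f (map (\<lambda>j. j + 2 - 2 * i) w) \<lesssim> map ?f (sub.cascades 4)"
    using assms by (intro sub.le_triangle) fastforce
  ultimately show ?thesis unfolding w block_def by simp
qed

text \<open>The triangle word on six strands bounds \<open>w\<close>. Up to commutation it is a
  product of three factors, in the upper, the lower and again the upper three letters, which
  \<open>B\<close>, \<open>A\<close>, \<open>B\<close> bound.\<close>

lemma le_three_blocks:
  fixes f :: "nat \<Rightarrow> nat"
  assumes f: "\<And>i. i \<in> {1..<6} \<Longrightarrow> f i \<in> {1..<n}"
      "\<And>i. i \<in> {1..<6} \<Longrightarrow> i + 1 \<in> {1..<6} \<Longrightarrow> f (i + 1) = f i + 1 \<or> f i = f (i + 1) + 1"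
      "\<And>i j. i \<in> {1..<6} \<Longrightarrow> j \<in> {1..<6} \<Longrightarrow> i + 1 < j \<Longrightarrow> f i + 1 < f j \<or> f j + 1 < f i"
    and A: "\<And>v. set v \<subseteq> f ` {1..3} \<Longrightarrow> v \<lesssim> A" and B: "\<And>v. set v \<subseteq> f ` {3..5} \<Longrightarrow> v \<lesssim> B"
    and w: "set w \<subseteq> f ` {1..5}"
  shows "w \<lesssim> B @ A @ B"
proof -
  interpret sub: hecke_order "\<lambda>v w. map f v \<lesssim> map f w" 6
    using f by (rule hecke_order_reindex)
  define u where "u = map (inv_into {1..5} f) w"
  have "map f u = w"
    unfolding u_def map_map using w by (intro map_idI) (auto simp: f_inv_into_f subset_iff)
  moreover have "set u \<subseteq> {1..5}"
    unfolding u_def set_map using w by (blast intro: inv_into_into)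
  ultimately have u: "w = map f u" "set u \<subseteq> {1..5}" by simp_all
  have "map f u \<lesssim> map f (sub.cascades 6)"
    using u by (intro sub.le_triangle) auto
  also have "sub.cascades 6 = [5, 4, 5, 3, 4, 5, 2, 3] @ ([4, 5] @ [1, 2]) @ [3, 4, 5]"
    by (simp add: sub.cascades_def upt_conv_Cons)
  \<comment> \<open>This exchange frees the middle factor \<open>[2, 3, 1, 2]\<close> from the
    letters 4 and 5.\<close>
  also have "map f \<dots> \<lesssim> map f ([5, 4, 5, 3, 4, 5, 2, 3] @ ([1, 2] @ [4, 5]) @ [3, 4, 5])"
    by (intro sub.le_cong sub.le_comm_words) auto
  also have "\<dots> = map f [5, 4, 5, 3, 4, 5] @ map f [2, 3, 1, 2] @ map f [4, 5, 3, 4, 5]" by simp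
  also have "\<dots> \<lesssim> B @ A @ B" by (intro le_append A B) auto
  finally show ?thesis by (simp add: u)
qed

lemma le_adjacent_blocks:
  assumes "1 \<le> i" "1 \<le> j" "2 * i + 1 < n" "2 * j + 1 < n" "j = i + 1 \<or> i = j + 1"
  shows "block i @ block j @ block i \<lesssim> block j @ block i @ block j"
proof -
  \<comment> \<open>Ascending or descending, so that the letters 1 to 3 always land in block
    \<open>i\<close> and 3 to 5 in block \<open>j\<close>; one bound then serves both directions of
    the turnover.\<close>
  obtain f :: "nat \<Rightarrow> nat" where
    f: "f = (if j = i + 1 then (\<lambda>x. x + 2 * i - 2) else (\<lambda>x. 2 * i + 2 - x))" by blast
  have img: "f ` {1..3} = {2 * i - 1..2 * i + 1}" "f ` {3..5} = {2 * j - 1..2 * j + 1}"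
  proof -
    have 1: "{1..3} = {1, 2, 3 :: nat}" "{3..5} = {3, 4, 5 :: nat}" by auto
    show "f ` {1..3} = {2 * i - 1..2 * i + 1}" "f ` {3..5} = {2 * j - 1..2 * j + 1}"
      using assms unfolding f 1 by auto
  qed
  show ?thesis
  proof (rule le_three_blocks[of f])
    show "f x \<in> {1..<n}" if "x \<in> {1..<6}" for x
      using that assms unfolding f by auto
    show "f (x + 1) = f x + 1 \<or> f x = f (x + 1) + 1" if "x \<in> {1..<6}" "x + 1 \<in> {1..<6}" for x
      using that assms unfolding f by auto
    show "f x + 1 < f y \<or> f y + 1 < f x" if "x \<in> {1..<6}" "y \<in> {1..<6}" "x + 1 < y" for x y
      using that assms unfolding f by auto
    show "v \<lesssim> block i" if "set v \<subseteq> f ` {1..3}" for v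
      using that assms unfolding img by (intro le_block) auto
    show "v \<lesssim> block j" if "set v \<subseteq> f ` {3..5}" for v
      using that assms unfolding img by (intro le_block) auto
    have "{1..5} = {1..3} \<union> {3..5 :: nat}" by auto
    then have "f ` {1..5} = {2 * i - 1..2 * i + 1} \<union> {2 * j - 1..2 * j + 1}"
      by (simp only: image_Un img)
    then show "set (block i @ block j @ block i) \<subseteq> f ` {1..5}"
      using assms by (simp add: set_block)
  qed
qed

text \<open>Blocks at distant positions consist of distant letters. Unit and fusion follow from
  \<open>le_block\<close>, since a block bounds every word in its own letters.\<close>

lemma hecke_order_blocks:
  assumes "n = 2 * m"
  shows "hecke_order (\<lambda>v w. concat (map block v) \<lesssim> concat (map block w)) m"
proof
  fix i j assume ij: "i \<in> {1..<m}" "j \<in> {1..<m}"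
  show "concat (map block [i, j]) \<lesssim> concat (map block [j, i])" if "i + 1 < j \<or> j + 1 < i"
  proof -
    have "block i @ block j \<lesssim> block j @ block i"
      using ij that assms by (intro le_comm_words) (auto simp: set_block)
    then show ?thesis by simp
  qed
  show "concat (map block [i, j, i]) \<lesssim> concat (map block [j, i, j])" if "j = i + 1 \<or> i = j + 1"
    using le_adjacent_blocks[of i j] ij that assms by simp
next
  fix i assume i: "i \<in> {1..<m}"
  show "concat (map block []) \<lesssim> concat (map block [i])"
    using le_block[of i "[]"] i assms by simp
  show "concat (map block [i, i]) \<lesssim> concat (map block [i])"
    using le_block[of i "block i @ block i"] i assms by (simp add: set_block)
next
  fix u v w x y
  show "concat (map block w) \<lesssim> concat (map block w)" by (rule le_refl)
  show "concat (map block u) \<lesssim> concat (map block v) \<Longrightarrow>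
      concat (map block v) \<lesssim> concat (map block w) \<Longrightarrow>
      concat (map block u) \<lesssim> concat (map block w)"
    by (rule le_trans)
  show "concat (map block v) \<lesssim> concat (map block w) \<Longrightarrow>
      concat (map block (x @ v @ y)) \<lesssim> concat (map block (x @ w @ y))"
    using le_cong by simp
qed

end

section \<open>Rotations generated by involutions\<close>

text \<open>For an involution \<open>A\<close> this is the exponential of
  \<open>- \<i> * t * A\<close>.\<close>

definition rotation :: "complex mat \<Rightarrow> real \<Rightarrow> complex mat" where
  "rotation A t = complex_of_real (cos t) \<cdot>\<^sub>m 1\<^sub>m (dim_row A) + (- \<i> * complex_of_real (sin t)) \<cdot>\<^sub>m A"

lemma rotation_carrier [simp]: "A \<in> carrier_mat d d \<Longrightarrow> rotation A t \<in> carrier_mat d d"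
  by (auto simp: rotation_def)

lemma rotation_zero: "A \<in> carrier_mat d d \<Longrightarrow> rotation A 0 = 1\<^sub>m d"
  by (intro eq_matI) (auto simp: rotation_def)

lemma rotation_mult_left:
  assumes "A \<in> carrier_mat d d" "X \<in> carrier_mat d d"
  shows "rotation A t * X =
    complex_of_real (cos t) \<cdot>\<^sub>m X + (- \<i> * complex_of_real (sin t)) \<cdot>\<^sub>m (A * X)"
  unfolding rotation_def using assms
  by (subst add_mult_distrib_mat[of _ d d _ _ d]) (auto simp: mult_smult_assoc_mat[of _ d d _ d])

lemma rotation_mult_right:
  assumes "A \<in> carrier_mat d d" "X \<in> carrier_mat d d"
  shows "X * rotation A t =
    complex_of_real (cos t) \<cdot>\<^sub>m X + (- \<i> * complex_of_real (sin t)) \<cdot>\<^sub>m (X * A)"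
  unfolding rotation_def using assms
  by (subst mult_add_distrib_mat[of _ d d _ d]) (auto simp: mult_smult_distrib[of _ d d _ d])

lemma rotation_add:
  assumes "A \<in> carrier_mat d d" "A * A = 1\<^sub>m d"
  shows "rotation A s * rotation A t = rotation A (s + t)"
proof -
  have "A * rotation A t = complex_of_real (cos t) \<cdot>\<^sub>m A + (- \<i> * complex_of_real (sin t)) \<cdot>\<^sub>m 1\<^sub>m d"
    using assms by (simp add: rotation_mult_right[of _ d])
  then show ?thesis
    unfolding rotation_mult_left[OF assms(1) rotation_carrier[OF assms(1)]]
    using assms(1) by (intro eq_matI)
      (auto simp: rotation_def cos_add sin_add algebra_simps)
qed

lemma rotation_comm:
  assumes "A \<in> carrier_mat d d" "X \<in> carrier_mat d d" "A * X = X * A"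
  shows "rotation A t * X = X * rotation A t"
  using assms by (simp add: rotation_mult_left[of _ d] rotation_mult_right[of _ d])

lemma rotation_anticomm:
  assumes "A \<in> carrier_mat d d" "X \<in> carrier_mat d d" "A * X = - (X * A)"
  shows "X * rotation A t = rotation A (- t) * X"
  unfolding rotation_mult_left[OF assms(1,2)] rotation_mult_right[OF assms(1,2)] assms(3)
  using assms(1,2) by (intro eq_matI) (auto simp del: index_mult_mat(1))

section \<open>Euler angles\<close>

text \<open>Expanding the middle factor leaves \<open>B\<close> to be moved past
  \<open>rotation A u\<close>, which turns \<open>u\<close> into \<open>- u\<close>.\<close>

lemma rotation_euler_form:
  assumes A: "A \<in> carrier_mat d d" "A * A = 1\<^sub>m d" and B: "B \<in> carrier_mat d d"
    and AB: "A * B = - (B * A)"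
  shows "rotation A s * rotation B t * rotation A u =
    complex_of_real (cos t) \<cdot>\<^sub>m rotation A (s + u) +
    (- \<i> * complex_of_real (sin t)) \<cdot>\<^sub>m (rotation A (s - u) * B)"
proof -
  have "rotation A s * rotation B t * rotation A u =
      complex_of_real (cos t) \<cdot>\<^sub>m (rotation A s * rotation A u) +
      (- \<i> * complex_of_real (sin t)) \<cdot>\<^sub>m (rotation A s * (B * rotation A u))"
    using A B unfolding rotation_mult_right[OF B rotation_carrier[OF A(1)]]
    by (subst add_mult_distrib_mat[of _ d d _ _ d])
      (auto simp: mult_smult_assoc_mat[of _ d d _ d] assoc_mult_mat[of _ d d _ d _ d]
        mult_carrier_mat[of _ d d _ d])
  also have "rotation A s * (B * rotation A u) = rotation A (s - u) * B"
    using A B rotation_add[OF A, of s "- u"]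
    by (simp add: rotation_anticomm[OF A(1) B AB] flip: assoc_mult_mat[of _ d d _ d _ d])
  finally show ?thesis unfolding rotation_add[OF A] .
qed

text \<open>Coordinates with respect to \<open>1\<close>, \<open>A\<close>, \<open>B\<close>,
  \<open>A * B\<close>; their real factors form a unit quaternion.\<close>

lemma rotation_euler_coords:
  assumes A: "A \<in> carrier_mat d d" "A * A = 1\<^sub>m d" and B: "B \<in> carrier_mat d d"
    and AB: "A * B = - (B * A)"
  shows "rotation A s * rotation B t * rotation A u =
    complex_of_real (cos t * cos (s + u)) \<cdot>\<^sub>m 1\<^sub>m d +
    ((- \<i> * complex_of_real (cos t * sin (s + u))) \<cdot>\<^sub>m A +
    ((- \<i> * complex_of_real (sin t * cos (s - u))) \<cdot>\<^sub>m B +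
    complex_of_real (- (sin t * sin (s - u))) \<cdot>\<^sub>m (A * B)))"
  unfolding rotation_euler_form[OF assms] rotation_mult_left[OF A(1) B]
  using A(1) B by (intro eq_matI) (auto simp del: index_mult_mat(1) simp: rotation_def algebra_simps)

lemma polar_real:
  fixes x y r :: real
  assumes "r\<^sup>2 = x\<^sup>2 + y\<^sup>2"
  obtains \<phi> where "x = r * cos \<phi>" "y = r * sin \<phi>"
proof (cases "r = 0")
  case True
  then show ?thesis using assms that[of 0] by (simp add: sum_power2_eq_zero_iff)
next
  case False
  then have "(x / r)\<^sup>2 + (y / r)\<^sup>2 = 1"
    by (simp add: power_divide flip: add_divide_distrib assms)
  then obtain \<phi> where "x / r = cos \<phi>" "y / r = sin \<phi>" by (metis sincos_total_2pi)
  then show ?thesis using False that[of \<phi>] by (simp add: field_simps)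
qed

text \<open>Two parametrisations of the unit quaternions by Euler angles.\<close>

lemma euler_angles_exchange:
  fixes s t u :: real
  obtains s' t' u' where
    "cos t' * cos (s' + u') = cos t * cos (s + u)" "cos t' * sin (s' + u') = sin t * cos (s - u)"
    "sin t' * cos (s' - u') = cos t * sin (s + u)" "sin t' * sin (s' - u') = - (sin t * sin (s - u))"
proof -
  define w where "w = cos t * cos (s + u)"
  define x where "x = sin t * cos (s - u)"
  define y where "y = cos t * sin (s + u)"
  define z where "z = - (sin t * sin (s - u))"
  note defs = w_def x_def y_def z_def
  have "w\<^sup>2 + y\<^sup>2 = (cos t)\<^sup>2" "x\<^sup>2 + z\<^sup>2 = (sin t)\<^sup>2"
    unfolding defs by (simp_all add: power_mult_distrib flip: distrib_left)
  then have "(w\<^sup>2 + x\<^sup>2) + (y\<^sup>2 + z\<^sup>2) = 1"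
    using sin_cos_squared_add[of t] by linarith
  \<comment> \<open>The coordinates form a unit vector. Pairing \<open>w\<close> with
    \<open>x\<close> and \<open>y\<close> with \<open>z\<close>, the lengths of the pairs give
    \<open>t'\<close> and their directions give \<open>p\<close> and \<open>q\<close>.\<close>
  then have "1\<^sup>2 = (sqrt (w\<^sup>2 + x\<^sup>2))\<^sup>2 + (sqrt (y\<^sup>2 + z\<^sup>2))\<^sup>2" by simp
  then obtain t' where t': "sqrt (w\<^sup>2 + x\<^sup>2) = cos t'" "sqrt (y\<^sup>2 + z\<^sup>2) = sin t'"
    by (elim polar_real) simp
  then have "(cos t')\<^sup>2 = w\<^sup>2 + x\<^sup>2" "(sin t')\<^sup>2 = y\<^sup>2 + z\<^sup>2"
    by (simp_all flip: t')
  then obtain p q where "w = cos t' * cos p" "x = cos t' * sin p" "y = sin t' * cos q" "z = sin t' * sin q"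
    by (metis polar_real)
  \<comment> \<open>Solves \<open>s' + u' = p\<close> and \<open>s' - u' = q\<close>.\<close>
  moreover have "(p + q) / 2 + (p - q) / 2 = p" "(p + q) / 2 - (p - q) / 2 = q"
    by (simp_all add: field_simps)
  ultimately show ?thesis
    using that[of t' "(p + q) / 2" "(p - q) / 2"] by (simp flip: defs)
qed

text \<open>Exchanging \<open>A\<close> and \<open>B\<close> swaps the second and third coordinate
  and, as \<open>B * A = - (A * B)\<close>, negates the fourth; \<open>euler_angles_exchange\<close>
  solves this system.\<close>

lemma rotation_euler_exchange:
  assumes A: "A \<in> carrier_mat d d" "A * A = 1\<^sub>m d" and B: "B \<in> carrier_mat d d" "B * B = 1\<^sub>m d"
    and AB: "A * B = - (B * A)"
  obtains s' t' u' where "rotation A s * rotation B t * rotation A u =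
    rotation B s' * rotation A t' * rotation B u'"
proof -
  obtain s' t' u' where e:
    "cos t' * cos (s' + u') = cos t * cos (s + u)" "cos t' * sin (s' + u') = sin t * cos (s - u)"
    "sin t' * cos (s' - u') = cos t * sin (s + u)" "sin t' * sin (s' - u') = - (sin t * sin (s - u))"
    by (rule euler_angles_exchange)
  have BA: "B * A = - (A * B)" using A B AB by (simp add: uminus_uminus_mat)
  have "rotation A s * rotation B t * rotation A u = rotation B s' * rotation A t' * rotation B u'"
    unfolding rotation_euler_coords[OF A B(1) AB] rotation_euler_coords[OF B A(1) BA] e AB
    using A(1) B(1) by (intro eq_matI) (auto simp del: index_mult_mat(1))
  then show ?thesis by (rule that)
qed

lemma mult_mult_swap:
  assumes "P \<in> carrier_mat d d" "X \<in> carrier_mat d d" "Q \<in> carrier_mat d d" "Y \<in> carrier_mat d d"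
    and "X * Q = Q * X"
  shows "(P * X) * (Q * Y) = (P * Q) * (X * (Y :: 'a :: semiring_0 mat))"
proof -
  have "(P * X) * (Q * Y) = P * ((X * Q) * Y)"
    using assms(1-4) by (simp add: assoc_mult_mat[of _ d d _ d _ d] mult_carrier_mat[of _ d d _ d])
  also have "\<dots> = (P * Q) * (X * Y)"
    unfolding assms(5)
    using assms(1-4) by (simp add: assoc_mult_mat[of _ d d _ d _ d] mult_carrier_mat[of _ d d _ d])
  finally show ?thesis .
qed

lemma commute_mult:
  assumes "X \<in> carrier_mat d d" "Y \<in> carrier_mat d d" "Z \<in> carrier_mat d d"
    and "X * Z = Z * X" "Y * Z = Z * Y"
  shows "X * Y * Z = Z * (X * (Y :: 'a :: semiring_0 mat))"
proof -
  have "X * Y * Z = X * Z * Y"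
    using assms(1-3,5) by (simp add: assoc_mult_mat[of _ d d _ d _ d])
  also have "\<dots> = Z * (X * Y)"
    unfolding assms(4) using assms(1-3) by (simp add: assoc_mult_mat[of _ d d _ d _ d])
  finally show ?thesis .
qed

section \<open>The group Spin(4) of one gate\<close>

text \<open>Models a gate at \<open>i\<close>: \<open>A\<close> and \<open>C\<close> are \<gamma> at
  the sites \<open>i\<close> and \<open>i + 1\<close>, \<open>B\<close> is \<alpha>\<alpha> on
  both.\<close>

locale involution_triple =
  fixes d :: nat and A B C :: "complex mat"
  assumes carrier [simp]: "A \<in> carrier_mat d d" "B \<in> carrier_mat d d" "C \<in> carrier_mat d d"
    and squares: "A * A = 1\<^sub>m d" "B * B = 1\<^sub>m d" "C * C = 1\<^sub>m d"
    and AB: "A * B = - (B * A)" and BC: "B * C = - (C * B)" and AC: "A * C = C * A"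
begin

lemmas mult_closed [simp] = mult_carrier_mat[of _ d d _ d]
lemmas dims [simp] = carrier_matD[OF carrier(1)] carrier_matD[OF carrier(2)] carrier_matD[OF carrier(3)]
lemmas assoc = assoc_mult_mat[of _ d d _ d _ d]

definition K where "K = A * C"

lemma K_carrier [simp]: "K \<in> carrier_mat d d"
  by (simp add: K_def)

lemmas K_dims [simp] = carrier_matD[OF K_carrier]

lemma K_A: "K * A = C" "A * K = C"
proof -
  show "A * K = C"
    using squares by (simp add: K_def left_mult_one_mat[of _ d d] flip: assoc)
  have "K * A = C * (A * A)" unfolding K_def AC by (simp add: assoc)
  then show "K * A = C" by (simp add: squares right_mult_one_mat[of _ d d])
qed

lemma K_square: "K * K = 1\<^sub>m d"
proof -
  have "K * K = C * (A * K)" unfolding K_def AC by (simp add: assoc)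
  then show ?thesis by (simp add: K_A squares)
qed

text \<open>\<open>B\<close> anticommutes with both factors of \<open>K\<close>, and the signs
  cancel.\<close>

lemma K_B: "K * B = B * K"
proof -
  have "C * B = - (B * C)" using BC by (simp add: uminus_uminus_mat)
  then have "K * B = - (A * (B * C))" by (simp add: K_def assoc)
  also have "\<dots> = - (A * B) * C" by (simp add: assoc)
  also have "\<dots> = B * K" unfolding AB by (simp add: K_def assoc uminus_uminus_mat)
  finally show ?thesis .
qed

text \<open>The spectral projections of \<open>K\<close> for the eigenvalues 1 and -1.\<close>

definition Pp where "Pp = (1 / 2) \<cdot>\<^sub>m 1\<^sub>m d + (1 / 2) \<cdot>\<^sub>m K"
definition Pm where "Pm = (1 / 2) \<cdot>\<^sub>m 1\<^sub>m d + (- 1 / 2) \<cdot>\<^sub>m K"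

lemma Pp_carrier [simp]: "Pp \<in> carrier_mat d d" and Pm_carrier [simp]: "Pm \<in> carrier_mat d d"
  by (simp_all add: Pp_def Pm_def)

lemmas P_dims [simp] = carrier_matD[OF Pp_carrier] carrier_matD[OF Pm_carrier]

lemma P_mult:
  assumes "X \<in> carrier_mat d d"
  shows "Pp * X = (1 / 2) \<cdot>\<^sub>m X + (1 / 2) \<cdot>\<^sub>m (K * X)"
    and "Pm * X = (1 / 2) \<cdot>\<^sub>m X + (- 1 / 2) \<cdot>\<^sub>m (K * X)"
    and "X * Pp = (1 / 2) \<cdot>\<^sub>m X + (1 / 2) \<cdot>\<^sub>m (X * K)"
    and "X * Pm = (1 / 2) \<cdot>\<^sub>m X + (- 1 / 2) \<cdot>\<^sub>m (X * K)"
  unfolding Pp_def Pm_def using assms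
  by (simp_all add: add_mult_distrib_mat[of _ d d _ _ d] mult_add_distrib_mat[of _ d d _ d]
      mult_smult_assoc_mat[of _ d d _ d] mult_smult_distrib[of _ d d _ d])

lemma K_P: "K * Pp = Pp" "K * Pm = - Pm"
  by (rule eq_matI; simp add: P_mult K_square del: index_mult_mat(1); simp add: Pp_def Pm_def)+

lemma P_idem: "Pp * Pp = Pp" "Pm * Pm = Pm" "Pp * Pm = 0\<^sub>m d d" "Pm * Pp = 0\<^sub>m d d"
  by (rule eq_matI; simp add: P_mult(1,2) K_P del: index_mult_mat(1))+

text \<open>\<open>K\<close> is a central involution of the algebra generated by \<open>A\<close>, \<open>B\<close>, \<open>C\<close>. On its eigenspaces
  \<open>C\<close> acts as \<open>A\<close> and \<open>- A\<close>, so that \<open>split\<close> identifies the group \<open>Spin(4)\<close> of the gates with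
  \<open>SU(2) \<times> SU(2)\<close>.\<close>

definition split where "split X Y = Pp * X + Pm * Y"

lemma split_carrier [simp]:
  "X \<in> carrier_mat d d \<Longrightarrow> Y \<in> carrier_mat d d \<Longrightarrow> split X Y \<in> carrier_mat d d"
  by (simp add: split_def)

text \<open>Operators commuting with \<open>K\<close> preserve its eigenspaces, so the components
  multiply separately; the cross terms contain \<open>Pp * Pm\<close> or
  \<open>Pm * Pp\<close>.\<close>

lemma split_mult:
  assumes [simp]: "X \<in> carrier_mat d d" "Y \<in> carrier_mat d d" "X' \<in> carrier_mat d d" "Y' \<in> carrier_mat d d"
    and K: "X * K = K * X" "Y * K = K * Y"
  shows "split X Y * split X' Y' = split (X * X') (Y * Y')"
proof -
  have comm: "X * Pp = Pp * X" "X * Pm = Pm * X" "Y * Pp = Pp * Y" "Y * Pm = Pm * Y"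
    by (simp_all add: P_mult K)
  have "split X Y * split X' Y' =
      (Pp * X) * (Pp * X') + (Pm * Y) * (Pp * X') + ((Pp * X) * (Pm * Y') + (Pm * Y) * (Pm * Y'))"
    unfolding split_def
    by (simp add: add_mult_distrib_mat[of _ d d _ _ d] mult_add_distrib_mat[of _ d d _ d])
  also have "(Pp * X) * (Pp * X') = Pp * (X * X')"
    by (subst mult_mult_swap[of _ d]) (simp_all add: comm P_idem left_mult_zero_mat[of _ d d])
  also have "(Pm * Y) * (Pp * X') = 0\<^sub>m d d"
    by (subst mult_mult_swap[of _ d]) (simp_all add: comm P_idem left_mult_zero_mat[of _ d d])
  also have "(Pp * X) * (Pm * Y') = 0\<^sub>m d d"
    by (subst mult_mult_swap[of _ d]) (simp_all add: comm P_idem left_mult_zero_mat[of _ d d])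
  also have "(Pm * Y) * (Pm * Y') = Pm * (Y * Y')"
    by (subst mult_mult_swap[of _ d]) (simp_all add: comm P_idem left_mult_zero_mat[of _ d d])
  finally show ?thesis
    by (simp add: split_def left_add_zero_mat[of _ d d] right_add_zero_mat[of _ d d])
qed

lemma split_diag: "X \<in> carrier_mat d d \<Longrightarrow> split X X = X"
  unfolding split_def P_mult by (intro eq_matI) (auto simp del: index_mult_mat(1))

lemma rotation_K:
  "rotation A t * K = K * rotation A t" "rotation B t * K = K * rotation B t"
  by (simp_all add: rotation_comm[of _ d] K_A K_B)

lemma rotation_C: "rotation C t = split (rotation A t) (rotation A (- t))"
  unfolding split_def P_mult[OF rotation_carrier[OF carrier(1)]]
    rotation_mult_right[OF carrier(1) K_carrier] K_A
  by (intro eq_matI) (auto simp: rotation_def algebra_simps)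

lemma rotation_AB: "rotation A t = split (rotation A t) (rotation A t)"
    "rotation B t = split (rotation B t) (rotation B t)"
  by (simp_all add: split_diag)

text \<open>This is \<beta>\<beta> on the two sites, by \<open>local_op_third\<close>.\<close>

definition D where "D = - (A * C * B)"

lemma D_carrier [simp]: "D \<in> carrier_mat d d"
  by (simp add: D_def)

text \<open>\<open>D\<close> is \<open>- (K * B)\<close>, hence acts as \<open>- B\<close> and
  \<open>B\<close> on the eigenspaces of \<open>K\<close>.\<close>

lemma rotation_D: "rotation D t = split (rotation B (- t)) (rotation B t)"
proof -
  have "rotation D t = rotation (- (K * B)) t" by (simp add: D_def K_def)
  also have "\<dots> = split (rotation B (- t)) (rotation B t)"
    unfolding split_def P_mult[OF rotation_carrier[OF carrier(2)]]
      rotation_mult_right[OF carrier(2) K_carrier]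
    by (intro eq_matI) (auto simp: rotation_def algebra_simps simp del: index_mult_mat(1))
  finally show ?thesis .
qed

definition euler where "euler x y z = rotation A x * rotation B y * rotation A z"

lemma euler_carrier [simp]: "euler x y z \<in> carrier_mat d d"
  by (simp add: euler_def)

lemma euler_K: "euler x y z * K = K * euler x y z"
  unfolding euler_def by (intro commute_mult[of _ d] mult_closed) (simp_all add: rotation_K)

text \<open>The two inner rotations about \<open>A\<close> merge; the remaining \<open>B\<close>,
  \<open>A\<close>, \<open>B\<close> product is exchanged for \<open>A\<close>, \<open>B\<close>,
  \<open>A\<close>, whose outer factors merge with the ends.\<close>

lemma euler_mult:
  obtains u v w where "euler x y z * euler x' y' z' = euler u v w"
proof -
  have BA: "B * A = - (A * B)" using AB by (simp add: uminus_uminus_mat)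
  obtain s t r where *: "rotation B y * rotation A (z + x') * rotation B y' =
      rotation A s * rotation B t * rotation A r"
    using rotation_euler_exchange[OF carrier(2) squares(2) carrier(1) squares(1) BA] by metis
  have "euler x y z * euler x' y' z' =
      rotation A x * (rotation B y * rotation A (z + x') * rotation B y') * rotation A z'"
    by (simp add: euler_def assoc flip: rotation_add[OF carrier(1) squares(1)])
  also have "\<dots> = euler (x + s) t (r + z')"
    unfolding * by (simp add: euler_def assoc flip: rotation_add[OF carrier(1) squares(1)])
  finally show ?thesis by (rule that)
qed

definition gates where
  "gates = {rotation A p * rotation C q * rotation B s * rotation D t * rotation A p' * rotation C q' |
    p q s t p' q'. True}"

text \<open>\<open>C\<close> repeats \<open>A\<close> on one eigenspace of \<open>K\<close> and
  inverts it on the other, and likewise \<open>D\<close> for \<open>B\<close>; the angles therefore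
  enter as sums and differences.\<close>

lemma gate_split:
  "rotation A p * rotation C q * rotation B s * rotation D t * rotation A p' * rotation C q' =
    split (euler (p + q) (s - t) (p' + q')) (euler (p - q) (s + t) (p' - q'))"
proof -
  have AC: "rotation A p * rotation C q = split (rotation A (p + q)) (rotation A (p - q))" for p q
    by (subst rotation_AB(1), subst rotation_C)
      (simp add: split_mult rotation_K rotation_add[OF carrier(1) squares(1)])
  have BD: "rotation B s * rotation D t = split (rotation B (s - t)) (rotation B (s + t))"
    by (subst rotation_AB(2), subst rotation_D)
      (simp add: split_mult rotation_K rotation_add[OF carrier(2) squares(2)])
  have "rotation A p * rotation C q * rotation B s * rotation D t * rotation A p' * rotation C q' =
      (rotation A p * rotation C q) * (rotation B s * rotation D t) * (rotation A p' * rotation C q')"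
    by (simp add: assoc)
  then show ?thesis
    unfolding AC BD euler_def
    by (simp add: split_mult rotation_K commute_mult[of _ d])
qed

text \<open>Sum and difference of two reals are arbitrary, so the two Euler products vary
  independently.\<close>

lemma gates_split: "gates = {split (euler x y z) (euler x' y' z') | x y z x' y' z'. True}"
proof -
  have "split (euler x y z) (euler x' y' z') \<in> gates" for x y z x' y' z'
  proof -
    have "(x + x') / 2 + (x - x') / 2 = x" "(x + x') / 2 - (x - x') / 2 = x'" for x x' :: real
      by (simp_all add: field_simps)
    then have "split (euler x y z) (euler x' y' z') =
      split (euler ((x + x') / 2 + (x - x') / 2) ((y' + y) / 2 - (y' - y) / 2) ((z + z') / 2 + (z - z') / 2))
        (euler ((x + x') / 2 - (x - x') / 2) ((y' + y) / 2 + (y' - y) / 2) ((z + z') / 2 - (z - z') / 2))"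
      by simp
    then show ?thesis unfolding gate_split[symmetric] gates_def by blast
  qed
  then show ?thesis unfolding gates_def gate_split by blast
qed

lemma gates_mult:
  assumes "U \<in> gates" "V \<in> gates"
  shows "V * U \<in> gates"
proof -
  obtain x y z x' y' z' where U: "U = split (euler x y z) (euler x' y' z')"
    using assms(1) unfolding gates_split by blast
  obtain p q r p' q' r' where V: "V = split (euler p q r) (euler p' q' r')"
    using assms(2) unfolding gates_split by blast
  obtain s t u where 1: "euler p q r * euler x y z = euler s t u" by (rule euler_mult)
  obtain s' t' u' where 2: "euler p' q' r' * euler x' y' z' = euler s' t' u'" by (rule euler_mult)
  have "V * U = split (euler s t u) (euler s' t' u')"
    unfolding U V by (simp add: split_mult euler_K 1 2)
  then show ?thesis unfolding gates_split by blast
qed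

lemma rotation_in_gates: "rotation A t \<in> gates" "rotation B t \<in> gates" "rotation C t \<in> gates"
  "1\<^sub>m d \<in> gates"
proof -
  have zero: "rotation A 0 = 1\<^sub>m d" "rotation B 0 = 1\<^sub>m d" "rotation C 0 = 1\<^sub>m d" "rotation D 0 = 1\<^sub>m d"
    by (simp_all add: rotation_zero[of _ d])
  have in_gates: "rotation A p * rotation C q * rotation B s * rotation D t * rotation A p' * rotation C q' \<in> gates"
    for p q s t p' q'
    unfolding gates_def by blast
  show "rotation A t \<in> gates" using in_gates[of t 0 0 0 0 0] by (simp add: zero left_mult_one_mat[of _ d d] right_mult_one_mat[of _ d d])
  show "rotation B t \<in> gates" using in_gates[of 0 0 t 0 0 0] by (simp add: zero left_mult_one_mat[of _ d d] right_mult_one_mat[of _ d d])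
  show "rotation C t \<in> gates" using in_gates[of 0 t 0 0 0 0] by (simp add: zero left_mult_one_mat[of _ d d] right_mult_one_mat[of _ d d])
  show "1\<^sub>m d \<in> gates" using in_gates[of 0 0 0 0 0 0] by (simp add: zero left_mult_one_mat[of _ d d] right_mult_one_mat[of _ d d])
qed

text \<open>On the two eigenspaces of \<open>K\<close> the right-hand side is the conjugate of \<open>rotation B t\<close> by
  \<open>rotation A (pi / 2)\<close> and \<open>rotation B t\<close> itself.\<close>

lemma rotation_D_conj:
  "rotation D t = rotation A (pi / 4) * rotation C (pi / 4) * rotation B t *
    rotation A (- pi / 4) * rotation C (- pi / 4)"
proof -
  have "euler (pi / 2) t (- (pi / 2)) = rotation B (- t)"
    unfolding euler_def rotation_euler_coords[OF carrier(1) squares(1) carrier(2) AB]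
    by (intro eq_matI) (auto simp: rotation_def simp del: index_mult_mat(1))
  moreover have "euler 0 t 0 = rotation B t"
    by (simp add: euler_def rotation_zero[of _ d] left_mult_one_mat[of _ d d] right_mult_one_mat[of _ d d])
  moreover have "rotation D 0 = 1\<^sub>m d" by (simp add: rotation_zero[of _ d])
  \<comment> \<open>Equal angles \<open>pi / 4\<close> add up to \<open>pi / 2\<close> on one
    eigenspace and cancel on the other.\<close>
  ultimately show ?thesis
    using gate_split[of "pi / 4" "pi / 4" t 0 "- pi / 4" "- pi / 4"] rotation_D
    by (simp add: right_mult_one_mat[of _ d d])
qed

end

section \<open>Pauli operators\<close>

lemma rotation_half_angle_mat_exp:
  assumes S: "S \<in> carrier_mat d d" "S * S = 1\<^sub>m d"
  shows "mat_exp ((- \<i> * complex_of_real \<theta> / 2) \<cdot>\<^sub>m S) = rotation S (\<theta> / 2)"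
proof -
  define z where "z = - \<i> * complex_of_real \<theta> / 2"
  have pow: "(z \<cdot>\<^sub>m S) ^\<^sub>m k = z ^ k \<cdot>\<^sub>m (if even k then 1\<^sub>m d else S)" for k
  proof (induction k)
    case (Suc k)
    have "(z \<cdot>\<^sub>m S) ^\<^sub>m Suc k = (z ^ k * z) \<cdot>\<^sub>m ((if even k then 1\<^sub>m d else S) * S)"
      using S(1) by (simp add: Suc.IH mult_smult_assoc_mat[of _ d d _ d] mult_smult_distrib[of _ d d _ d])
        (auto intro!: eq_matI simp del: index_mult_mat(1))
    then show ?case using S by (simp add: left_mult_one_mat[of _ d d] mult.commute)
  qed (use S in \<open>auto intro!: eq_matI\<close>)
  have e: "exp z = cos (\<theta> / 2) - \<i> * sin (\<theta> / 2)" "exp (- z) = cos (\<theta> / 2) + \<i> * sin (\<theta> / 2)"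
    using cis_conv_exp[of "\<theta> / 2"] cis_conv_exp[of "- \<theta> / 2"]
    by (simp_all add: z_def cis.ctr complex_eq_iff)
  have entry: "(\<Sum>k. (1 / fact k) * ((z \<cdot>\<^sub>m S) ^\<^sub>m k) $$ (i, j)) = rotation S (\<theta> / 2) $$ (i, j)"
    if ij: "i < d" "j < d" for i j
  proof -
    \<comment> \<open>Entries of the spectral projections \<open>(1 + S) / 2\<close> and
      \<open>(1 - S) / 2\<close>, on whose ranges \<open>S\<close> acts as 1 and -1; this leaves two
      scalar exponential series.\<close>
    let ?u = "(1\<^sub>m d $$ (i, j) + S $$ (i, j)) / 2" and ?v = "(1\<^sub>m d $$ (i, j) - S $$ (i, j)) / 2"
    have "(\<lambda>k. ?u * (z ^ k /\<^sub>R fact k) + ?v * ((- z) ^ k /\<^sub>R fact k)) sums (?u * exp z + ?v * exp (- z))"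
      by (intro sums_add sums_mult exp_converges)
    moreover have "?u * (z ^ k /\<^sub>R fact k) + ?v * ((- z) ^ k /\<^sub>R fact k) =
        (1 / fact k) * ((z \<cdot>\<^sub>m S) ^\<^sub>m k) $$ (i, j)" for k
      using ij S(1) by (simp add: pow scaleR_conv_of_real power_minus[of z] field_simps)
    ultimately have "(\<Sum>k. (1 / fact k) * ((z \<cdot>\<^sub>m S) ^\<^sub>m k) $$ (i, j)) = ?u * exp z + ?v * exp (- z)"
      by (simp add: sums_iff)
    also have "\<dots> = rotation S (\<theta> / 2) $$ (i, j)"
      using ij S(1) by (simp add: e rotation_def field_simps)
    finally show ?thesis .
  qed
  show ?thesis
    unfolding z_def[symmetric] mat_exp_def
    using S(1) entry carrier_matD[OF rotation_carrier[OF S(1), of "\<theta> / 2"]]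
    by (intro eq_matI) auto
qed

section \<open>Kronecker and tensor products\<close>

lemma kron_dims [simp]:
  "dim_row (kron A B) = dim_row A * dim_row B" "dim_col (kron A B) = dim_col A * dim_col B"
  by (simp_all add: kron_def)

lemma kron_carrier: "A \<in> carrier_mat a b \<Longrightarrow> B \<in> carrier_mat c d \<Longrightarrow> kron A B \<in> carrier_mat (a * c) (b * d)"
  by auto

lemma kron_mult:
  assumes "A \<in> carrier_mat m n" "A' \<in> carrier_mat n p" "B \<in> carrier_mat k l" "B' \<in> carrier_mat l q"
  shows "kron A B * kron A' B' = kron (A * A') (B * B')"
proof (intro eq_matI)
  fix i j assume "i < dim_row (kron (A * A') (B * B'))" "j < dim_col (kron (A * A') (B * B'))"
  then have ij: "i < m * k" "j < p * q" using assms by auto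
  then have "0 < k" "0 < q" by (auto intro: gr0I)
  with ij have div: "i div k < m" "i mod k < k" "j div q < p" "j mod q < q"
    by (auto simp: less_mult_imp_div_less)
  let ?f = "\<lambda>r. A $$ (i div k, r div l) * B $$ (i mod k, r mod l) *
    (A' $$ (r div l, j div q) * B' $$ (r mod l, j mod q))"
  have "(kron A B * kron A' B') $$ (i, j) = (\<Sum>r<n * l. ?f r)"
    using assms ij by (auto simp: scalar_prod_def kron_def atLeast0LessThan)
  \<comment> \<open>The index \<open>r\<close> is split as \<open>s * l + t\<close>, the index pair
    of the two tensor factors.\<close>
  also have "\<dots> = (\<Sum>s<n. \<Sum>r\<in>{s * l..<s * l + l}. ?f r)"
    by (rule sum.nat_group[symmetric])
  also have "\<dots> = (\<Sum>s<n. \<Sum>t<l. ?f (s * l + t))"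
    by (simp add: sum.atLeastLessThan_shift_0 atLeast0LessThan comp_def)
  also have "\<dots> = (\<Sum>s<n. \<Sum>t<l. (A $$ (i div k, s) * A' $$ (s, j div q)) *
      (B $$ (i mod k, t) * B' $$ (t, j mod q)))"
    by (intro sum.cong refl) (auto simp: mult_ac)
  also have "\<dots> = (A * A') $$ (i div k, j div q) * (B * B') $$ (i mod k, j mod q)"
    using assms div by (auto simp: scalar_prod_def sum_product atLeast0LessThan)
  also have "\<dots> = kron (A * A') (B * B') $$ (i, j)"
    using assms ij by (auto simp: kron_def)
  finally show "(kron A B * kron A' B') $$ (i, j) = kron (A * A') (B * B') $$ (i, j)" .
qed (use assms in auto)

text \<open>Factors are indexed by sites, so that operators can be multiplied and compared site by
  site.\<close>

definition tensor_fun :: "(nat \<Rightarrow> complex mat) \<Rightarrow> nat list \<Rightarrow> complex mat" where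
  "tensor_fun f xs = tensor_list (map f xs)"

lemma tensor_fun_simps:
  "tensor_fun f [] = 1\<^sub>m 1" "tensor_fun f (i # xs) = kron (f i) (tensor_fun f xs)"
  by (simp_all add: tensor_fun_def tensor_list_def)

lemma tensor_fun_carrier:
  "(\<And>i. f i \<in> carrier_mat 2 2) \<Longrightarrow> tensor_fun f xs \<in> carrier_mat (2 ^ length xs) (2 ^ length xs)"
  by (induction xs) (auto simp: tensor_fun_simps intro!: kron_carrier)

lemma tensor_fun_mult:
  assumes "\<And>i. f i \<in> carrier_mat 2 2" "\<And>i. g i \<in> carrier_mat 2 2"
  shows "tensor_fun f xs * tensor_fun g xs = tensor_fun (\<lambda>i. f i * g i) xs"
proof (induction xs)
  case (Cons i xs)
  then show ?case
    using kron_mult[OF assms(1)[of i] assms(2)[of i] tensor_fun_carrier[of f xs] tensor_fun_carrier[of g xs]]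
      assms
    by (simp add: tensor_fun_simps)
qed (simp add: tensor_fun_simps)

lemma tensor_fun_one: "tensor_fun (\<lambda>_. 1\<^sub>m 2) xs = 1\<^sub>m (2 ^ length xs)"
proof (induction xs)
  case (Cons i xs)
  have "kron (1\<^sub>m m) (1\<^sub>m n) = 1\<^sub>m (m * n)" for m n
  proof (intro eq_matI)
    fix i j assume ij: "i < dim_row (1\<^sub>m (m * n) :: complex mat)" "j < dim_col (1\<^sub>m (m * n) :: complex mat)"
    then have "0 < n" by (auto intro: gr0I)
    moreover have "i = j \<longleftrightarrow> i div n = j div n \<and> i mod n = j mod n" by (metis div_mult_mod_eq)
    ultimately show "kron (1\<^sub>m m) (1\<^sub>m n) $$ (i, j) = 1\<^sub>m (m * n) $$ (i, j)"
      using ij by (auto simp: kron_def less_mult_imp_div_less)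
  qed auto
  then show ?case by (simp add: tensor_fun_simps Cons)
qed (simp add: tensor_fun_simps)

lemma kron_smult: "kron (c \<cdot>\<^sub>m A) B = c \<cdot>\<^sub>m kron A B" "kron A (c \<cdot>\<^sub>m B) = c \<cdot>\<^sub>m kron A B"
proof -
  have "i div dim_row B < dim_row A" "i mod dim_row B < dim_row B"
    if "i < dim_row A * dim_row B" for i and A B :: "complex mat"
    using that by (auto simp: less_mult_imp_div_less intro!: mod_less_divisor gr0I)
  moreover have "i div dim_col B < dim_col A" "i mod dim_col B < dim_col B"
    if "i < dim_col A * dim_col B" for i and A B :: "complex mat"
    using that by (auto simp: less_mult_imp_div_less intro!: mod_less_divisor gr0I)
  ultimately show "kron (c \<cdot>\<^sub>m A) B = c \<cdot>\<^sub>m kron A B" "kron A (c \<cdot>\<^sub>m B) = c \<cdot>\<^sub>m kron A B"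
    by (auto intro!: eq_matI simp: kron_def)
qed

lemma tensor_fun_smult:
  assumes "distinct xs"
  shows "tensor_fun (\<lambda>j. if j = i then c \<cdot>\<^sub>m f j else f j) xs =
    (if i \<in> set xs then c else 1) \<cdot>\<^sub>m tensor_fun f xs"
  using assms by (induction xs) (auto simp: tensor_fun_simps kron_smult)

section \<open>Pauli matrices and local operators\<close>

lemma pauli_carrier [simp]: "pauli a \<in> carrier_mat 2 2"
  by (cases a) (auto simp: mat_of_rows_list_def)

lemma mat2_eqI:
  assumes "A \<in> carrier_mat 2 2" "B \<in> carrier_mat 2 2"
    and "A $$ (0, 0) = B $$ (0, 0)" "A $$ (0, 1) = B $$ (0, 1)"
      "A $$ (1, 0) = B $$ (1, 0)" "A $$ (1, 1) = B $$ (1, 1)"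
  shows "A = B"
  using assms by (intro eq_matI) (auto simp: less_2_cases_iff)

lemma pauli_square: "pauli a * pauli a = 1\<^sub>m 2"
  by (rule mat2_eqI; cases a) (auto simp: mat_of_rows_list_def scalar_prod_def)

lemma pauli_anticomm: "a \<noteq> b \<Longrightarrow> pauli a * pauli b = (- 1) \<cdot>\<^sub>m (pauli b * pauli a)"
  by (rule mat2_eqI; cases a; cases b) (auto simp: mat_of_rows_list_def scalar_prod_def)

text \<open>\<open>k\<close> is \<i> or \<open>- \<i>\<close> according to the orientation of the
  axes; its square suffices where two sites contribute one factor each.\<close>

lemma pauli_mult_third:
  assumes "distinct [a, b, c]"
  obtains k where "k * k = - 1" "pauli a * pauli c = k \<cdot>\<^sub>m pauli b"
proof -
  have cyc: "pauli SX * pauli SY = \<i> \<cdot>\<^sub>m pauli SZ" "pauli SY * pauli SZ = \<i> \<cdot>\<^sub>m pauli SX"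
      "pauli SZ * pauli SX = \<i> \<cdot>\<^sub>m pauli SY" "pauli SY * pauli SX = (- \<i>) \<cdot>\<^sub>m pauli SZ"
      "pauli SZ * pauli SY = (- \<i>) \<cdot>\<^sub>m pauli SX" "pauli SX * pauli SZ = (- \<i>) \<cdot>\<^sub>m pauli SY"
    by (rule mat2_eqI; auto simp: mat_of_rows_list_def scalar_prod_def)+
  have "pauli a * pauli c = \<i> \<cdot>\<^sub>m pauli b \<or> pauli a * pauli c = (- \<i>) \<cdot>\<^sub>m pauli b"
    using assms by (cases a; cases b; cases c) (simp_all del: pauli.simps add: cyc)
  then show ?thesis using that[of "\<i>"] that[of "- \<i>"] by fastforce
qed

lemma tensor_fun_cong: "(\<And>i. i \<in> set xs \<Longrightarrow> f i = g i) \<Longrightarrow> tensor_fun f xs = tensor_fun g xs"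
  unfolding tensor_fun_def by (metis map_cong)

lemma tensor_fun_commute:
  assumes "\<And>i. f i \<in> carrier_mat 2 2" "\<And>i. g i \<in> carrier_mat 2 2" "\<And>i. f i * g i = g i * f i"
  shows "tensor_fun f xs * tensor_fun g xs = tensor_fun g xs * tensor_fun f xs"
  unfolding tensor_fun_mult[OF assms(1,2)] tensor_fun_mult[OF assms(2,1)] assms(3) ..

text \<open>The two products differ by a single sign, contributed at \<open>r\<close>.\<close>

lemma tensor_fun_anticommute:
  assumes "\<And>i. f i \<in> carrier_mat 2 2" "\<And>i. g i \<in> carrier_mat 2 2"
    and "\<And>i. i \<noteq> r \<Longrightarrow> f i * g i = g i * f i" "f r * g r = (- 1) \<cdot>\<^sub>m (g r * f r)"
    and "distinct xs" "r \<in> set xs"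
  shows "tensor_fun f xs * tensor_fun g xs = - (tensor_fun g xs * tensor_fun f xs)"
proof -
  have "tensor_fun f xs * tensor_fun g xs =
      tensor_fun (\<lambda>i. if i = r then (- 1) \<cdot>\<^sub>m (g i * f i) else g i * f i) xs"
    unfolding tensor_fun_mult[OF assms(1,2)] by (intro tensor_fun_cong) (use assms(3,4) in auto)
  also have "\<dots> = (- 1) \<cdot>\<^sub>m (tensor_fun g xs * tensor_fun f xs)"
    using assms(5,6) by (subst tensor_fun_smult) (simp_all add: tensor_fun_mult[OF assms(2,1)])
  finally show ?thesis by (auto intro!: eq_matI)
qed

text \<open>Treats site operators (singletons) and two-site products (neighbouring pairs)
  uniformly.\<close>

definition local_op :: "nat \<Rightarrow> axis \<Rightarrow> nat set \<Rightarrow> complex mat" where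
  "local_op N a I = tensor_fun (\<lambda>j. if j \<in> I then pauli a else 1\<^sub>m 2) [1..<N + 1]"

lemma local_op_carrier [simp]: "local_op N a I \<in> carrier_mat (2 ^ N) (2 ^ N)"
  unfolding local_op_def using tensor_fun_carrier[of _ "[1..<N + 1]"] by (simp del: upt_Suc)

lemma local_op_mult_disjoint:
  assumes "I \<inter> J = {}"
  shows "local_op N a I * local_op N a J = local_op N a (I \<union> J)"
  unfolding local_op_def using assms
  by (subst tensor_fun_mult) (auto intro!: tensor_fun_cong simp: left_mult_one_mat[of _ 2 2] right_mult_one_mat[of _ 2 2])

lemma local_op_square: "local_op N a I * local_op N a I = 1\<^sub>m (2 ^ N)"
proof -
  have "local_op N a I * local_op N a I = tensor_fun (\<lambda>_. 1\<^sub>m 2) [1..<N + 1]"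
    unfolding local_op_def
    by (subst tensor_fun_mult) (auto intro!: tensor_fun_cong simp: pauli_square)
  then show ?thesis by (simp add: tensor_fun_one del: upt_Suc)
qed

lemma local_op_commute:
  assumes "a = b \<or> I \<inter> J = {}"
  shows "local_op N a I * local_op N b J = local_op N b J * local_op N a I"
  unfolding local_op_def using assms
  by (intro tensor_fun_commute) (auto simp: left_mult_one_mat[of _ 2 2] right_mult_one_mat[of _ 2 2])

lemma local_op_anticommute:
  assumes "a \<noteq> b" "I \<inter> J = {r}" "r \<in> {1..N}"
  shows "local_op N a I * local_op N b J = - (local_op N b J * local_op N a I)"
  unfolding local_op_def
proof (rule tensor_fun_anticommute[of _ _ r])
  show "r \<in> set [1..<N + 1]" using assms(3) by (simp del: upt_Suc)
qed (use assms pauli_anticomm[OF assms(1)] in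
  \<open>auto simp: left_mult_one_mat[of _ 2 2] right_mult_one_mat[of _ 2 2]\<close>)

lemma site_pauli_eq: "i \<in> {1..N} \<Longrightarrow> site_pauli N a i = local_op N a {i}"
proof -
  assume i: "i \<in> {1..N}"
  have "replicate (i - 1) (1\<^sub>m 2) @ [pauli a] @ replicate (N - i) (1\<^sub>m 2) =
      map (\<lambda>j. if j \<in> {i} then pauli a else 1\<^sub>m 2) [1..<N + 1]"
    using i by (intro nth_equalityI) (auto simp: nth_append nth_Cons' simp del: upt_Suc)
  then show ?thesis unfolding site_pauli_def local_op_def tensor_fun_def by simp
qed

lemma site_pauli_mult_eq:
  "i \<in> {1..<N} \<Longrightarrow> site_pauli N a i * site_pauli N a (i + 1) = local_op N a {i, i + 1}"
  by (simp add: site_pauli_eq local_op_mult_disjoint insert_commute)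

lemma local_op_third:
  assumes "distinct [\<alpha>, \<beta>, \<gamma>]" "i \<in> {1..<N}"
  shows "local_op N \<beta> {i, i + 1} = - (local_op N \<gamma> {i} * local_op N \<gamma> {i + 1} * local_op N \<alpha> {i, i + 1})"
proof -
  obtain k where k: "k * k = - 1" "pauli \<gamma> * pauli \<alpha> = k \<cdot>\<^sub>m pauli \<beta>"
    using assms(1) by (elim pauli_mult_third[of \<gamma> \<beta> \<alpha>, rotated]) auto
  let ?one = "\<lambda>j. if j \<in> {i, i + 1} then pauli \<beta> else 1\<^sub>m 2"
  \<comment> \<open>One factor \<open>k\<close> at site \<open>i\<close>; a second conditional adds
    the one at \<open>i + 1\<close>, in the form that \<open>tensor_fun_smult\<close>
    extracts.\<close>
  let ?two = "\<lambda>j. if j = i then k \<cdot>\<^sub>m ?one j else ?one j"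
  have "local_op N \<gamma> {i} * local_op N \<gamma> {i + 1} * local_op N \<alpha> {i, i + 1} =
      local_op N \<gamma> {i, i + 1} * local_op N \<alpha> {i, i + 1}"
    by (simp add: local_op_mult_disjoint insert_commute)
  also have "\<dots> = tensor_fun (\<lambda>j. if j = i + 1 then k \<cdot>\<^sub>m ?two j else ?two j) [1..<N + 1]"
    unfolding local_op_def
    by (subst tensor_fun_mult) (auto intro!: tensor_fun_cong simp: k(2))
  also have "\<dots> = k \<cdot>\<^sub>m (k \<cdot>\<^sub>m local_op N \<beta> {i, i + 1})"
    using assms(2) unfolding local_op_def
    by (subst tensor_fun_smult, simp)+ (simp del: upt_Suc)
  also have "\<dots> = - local_op N \<beta> {i, i + 1}"
    using k(1) by (auto intro!: eq_matI simp flip: mult.assoc)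
  finally show ?thesis by (simp add: uminus_uminus_mat)
qed

text \<open>Under the Jordan-Wigner transformation with Majorana operators \<open>c 1, \<dots>, c (2 * N)\<close>, this is
  \<open>c j * c (j + 1)\<close> up to a phase.\<close>

definition majorana_pair :: "nat \<Rightarrow> axis \<Rightarrow> axis \<Rightarrow> nat \<Rightarrow> complex mat" where
  "majorana_pair N \<alpha> \<gamma> j =
    (if odd j then local_op N \<gamma> {(j + 1) div 2} else local_op N \<alpha> {j div 2, j div 2 + 1})"

lemma majorana_pair_carrier [simp]: "majorana_pair N \<alpha> \<gamma> j \<in> carrier_mat (2 ^ N) (2 ^ N)"
  by (simp add: majorana_pair_def)

lemma majorana_pair_square: "majorana_pair N \<alpha> \<gamma> j * majorana_pair N \<alpha> \<gamma> j = 1\<^sub>m (2 ^ N)"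
  by (simp add: majorana_pair_def local_op_square)

text \<open>Equal parity means equal axes; for opposite parity the distance keeps the sites
  disjoint.\<close>

lemma majorana_pair_commute:
  assumes "i + 1 < j \<or> j + 1 < i"
  shows "majorana_pair N \<alpha> \<gamma> i * majorana_pair N \<alpha> \<gamma> j = majorana_pair N \<alpha> \<gamma> j * majorana_pair N \<alpha> \<gamma> i"
proof -
  have "even i \<Longrightarrow> odd j \<Longrightarrow> {i div 2, i div 2 + 1} \<inter> {(j + 1) div 2} = {}"
    "odd i \<Longrightarrow> even j \<Longrightarrow> {(i + 1) div 2} \<inter> {j div 2, j div 2 + 1} = {}"
    using assms by (auto elim!: evenE oddE)
  then show ?thesis
    unfolding majorana_pair_def by (auto intro!: local_op_commute)
qed

text \<open>Neighbouring pairs share exactly one site and carry different axes there.\<close>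

lemma majorana_pair_anticommute:
  assumes "\<alpha> \<noteq> \<gamma>" "j = i + 1 \<or> i = j + 1" "i \<in> {1..<2 * N}" "j \<in> {1..<2 * N}"
  shows "majorana_pair N \<alpha> \<gamma> i * majorana_pair N \<alpha> \<gamma> j = - (majorana_pair N \<alpha> \<gamma> j * majorana_pair N \<alpha> \<gamma> i)"
proof (cases "odd i")
  case True
  then have j: "even j" using assms(2) by auto
  with True have "{(i + 1) div 2} \<inter> {j div 2, j div 2 + 1} = {(i + 1) div 2}" "(i + 1) div 2 \<in> {1..N}"
    using assms by (auto elim!: evenE oddE)
  then show ?thesis
    using True j assms(1) local_op_anticommute[of \<gamma> \<alpha> "{(i + 1) div 2}" "{j div 2, j div 2 + 1}"]
    by (auto simp: majorana_pair_def)
next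
  case False
  then have j: "odd j" using assms(2) by auto
  with False have "{i div 2, i div 2 + 1} \<inter> {(j + 1) div 2} = {(j + 1) div 2}" "(j + 1) div 2 \<in> {1..N}"
    using assms by (auto elim!: evenE oddE)
  then show ?thesis
    using False j assms(1) local_op_anticommute[of \<alpha> \<gamma> "{i div 2, i div 2 + 1}" "{(j + 1) div 2}"]
    by (auto simp: majorana_pair_def)
qed

section \<open>Circuits\<close>

text \<open>The head of the word acts first and is the rightmost factor, as in
  \<open>circuit_op\<close>.\<close>

fun word_ops :: "nat \<Rightarrow> ('l \<Rightarrow> complex mat set) \<Rightarrow> 'l list \<Rightarrow> complex mat set" where
  "word_ops d G [] = {1\<^sub>m d}"
| "word_ops d G (l # w) = {V * U | U V. U \<in> G l \<and> V \<in> word_ops d G w}"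

locale gate_family =
  fixes d :: nat and G :: "'l \<Rightarrow> complex mat set"
  assumes gate_carrier: "G l \<subseteq> carrier_mat d d"
begin

abbreviation ops where "ops \<equiv> word_ops d G"

lemma ops_carrier: "ops w \<subseteq> carrier_mat d d"
  using gate_carrier by (induction w) (auto intro!: mult_carrier_mat[of _ d d _ d])

lemma ops_singleton: "ops [l] = G l"
proof -
  have "1\<^sub>m d * U = U" if "U \<in> G l" for U
    using that gate_carrier[of l] by (auto intro!: left_mult_one_mat)
  then have "(\<lambda>U. 1\<^sub>m d * U) ` G l = id ` G l" by (intro image_cong) auto
  moreover have "ops [l] = (\<lambda>U. 1\<^sub>m d * U) ` G l" by auto
  ultimately show ?thesis by simp
qed

lemma ops_append: "ops (v @ w) = {V * U | U V. U \<in> ops v \<and> V \<in> ops w}"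
proof (induction v)
  case Nil
  have "V * 1\<^sub>m d = V" if "V \<in> ops w" for V
    using that ops_carrier[of w] by (auto intro!: right_mult_one_mat)
  then show ?case by force
next
  case (Cons l v)
  have assoc: "V * W * U = V * (W * U)" if "U \<in> G l" "W \<in> ops v" "V \<in> ops w" for U V W
    using that gate_carrier[of l] ops_carrier[of v] ops_carrier[of w]
    by (intro assoc_mult_mat[of _ d d _ d _ d]) auto
  show ?case
  proof (intro equalityI subsetI)
    fix X assume "X \<in> ops ((l # v) @ w)"
    then obtain U V W where X: "X = V * W * U" "U \<in> G l" "W \<in> ops v" "V \<in> ops w"
      by (auto simp: Cons.IH)
    then have "X = V * (W * U)" "W * U \<in> ops (l # v)" using assoc by auto
    then show "X \<in> {V * U | U V. U \<in> ops (l # v) \<and> V \<in> ops w}" using X(4) by blast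
  next
    fix X assume "X \<in> {V * U | U V. U \<in> ops (l # v) \<and> V \<in> ops w}"
    then obtain U V W where X: "X = V * (W * U)" "U \<in> G l" "W \<in> ops v" "V \<in> ops w"
      by auto
    then have "X = V * W * U" "V * W \<in> ops (v @ w)" using assoc Cons.IH by auto
    then show "X \<in> ops ((l # v) @ w)" using X(2) by auto
  qed
qed

lemma ops_appendI: "U \<in> ops v \<Longrightarrow> V \<in> ops w \<Longrightarrow> V * U \<in> ops (v @ w)"
  by (auto simp: ops_append)

lemma ops_append_mono: "ops v \<subseteq> ops v' \<Longrightarrow> ops w \<subseteq> ops w' \<Longrightarrow> ops (v @ w) \<subseteq> ops (v' @ w')"
  by (auto simp: ops_append)

lemma ops_concat:
  assumes "\<And>l. l \<in> set w \<Longrightarrow> H l = ops (f l)"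
  shows "word_ops d H w = ops (concat (map f w))"
  using assms by (induction w) (simp_all add: ops_append)

end

text \<open>The four assumptions are \<open>le_unit\<close>, \<open>le_idem\<close>,
  \<open>le_comm\<close> and \<open>le_braid\<close>, read for sets of operators ordered by
  inclusion.\<close>

lemma (in gate_family) hecke_order_ops:
  fixes f :: "nat \<Rightarrow> 'l"
  assumes unit: "\<And>i. i \<in> {1..<n} \<Longrightarrow> 1\<^sub>m d \<in> G (f i)"
    and fusion: "\<And>i U V. i \<in> {1..<n} \<Longrightarrow> U \<in> G (f i) \<Longrightarrow> V \<in> G (f i) \<Longrightarrow> V * U \<in> G (f i)"
    and commute: "\<And>i j U V. i \<in> {1..<n} \<Longrightarrow> j \<in> {1..<n} \<Longrightarrow> i + 1 < j \<or> j + 1 < i \<Longrightarrow>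
      U \<in> G (f i) \<Longrightarrow> V \<in> G (f j) \<Longrightarrow> V * U = U * V"
    and turnover: "\<And>i j U V W. i \<in> {1..<n} \<Longrightarrow> j \<in> {1..<n} \<Longrightarrow> j = i + 1 \<or> i = j + 1 \<Longrightarrow>
      U \<in> G (f i) \<Longrightarrow> V \<in> G (f j) \<Longrightarrow> W \<in> G (f i) \<Longrightarrow>
      \<exists>U'\<in>G (f j). \<exists>V'\<in>G (f i). \<exists>W'\<in>G (f j). W * V * U = W' * V' * U'"
  shows "hecke_order (\<lambda>v w. ops (map f v) \<subseteq> ops (map f w)) n"
proof
  have assoc: "W * (V * U) = W * V * U" if "U \<in> G k" "V \<in> G l" "W \<in> G m" for U V W k l m
    using that gate_carrier[of k] gate_carrier[of l] gate_carrier[of m]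
    by (intro assoc_mult_mat[of _ d d _ d _ d, symmetric]) auto
  have pair: "ops [k, l] = {V * U | U V. U \<in> G k \<and> V \<in> G l}" for k l
    using ops_append[of "[k]" "[l]"] by (simp add: ops_singleton del: word_ops.simps)
  have triple: "ops [k, l, m] = {W * (V * U) | U V W. U \<in> G k \<and> V \<in> G l \<and> W \<in> G m}" for k l m
    using ops_append[of "[k, l]" "[m]"] by (auto simp: ops_singleton pair simp del: word_ops.simps)
  fix i j assume ij: "i \<in> {1..<n}" "j \<in> {1..<n}"
  show "ops (map f [i, j]) \<subseteq> ops (map f [j, i])" if "i + 1 < j \<or> j + 1 < i"
  proof
    fix X assume "X \<in> ops (map f [i, j])"
    then obtain U V where X: "X = V * U" "U \<in> G (f i)" "V \<in> G (f j)"
      unfolding list.map pair by blast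
    then have "X = U * V" using commute[OF ij that] by simp
    then show "X \<in> ops (map f [j, i])" unfolding list.map pair using X by blast
  qed
  show "ops (map f [i, j, i]) \<subseteq> ops (map f [j, i, j])" if adj: "j = i + 1 \<or> i = j + 1"
  proof
    fix X assume "X \<in> ops (map f [i, j, i])"
    then obtain U V W where "X = W * (V * U)" "U \<in> G (f i)" "V \<in> G (f j)" "W \<in> G (f i)"
      unfolding list.map triple by blast
    then obtain U' V' W' where X: "X = W' * V' * U'" "U' \<in> G (f j)" "V' \<in> G (f i)" "W' \<in> G (f j)"
      using turnover[OF ij adj, of U V W] by (auto simp: assoc)
    then have "X = W' * (V' * U')" using assoc by simp
    then show "X \<in> ops (map f [j, i, j])" unfolding list.map triple using X by blast
  qed
next
  fix i assume i: "i \<in> {1..<n}"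
  show "ops (map f []) \<subseteq> ops (map f [i])"
    using unit[OF i] by (simp add: ops_singleton del: word_ops.simps(2))
  show "ops (map f [i, i]) \<subseteq> ops (map f [i])"
    using fusion[OF i] ops_append[of "[f i]" "[f i]"]
    by (auto simp: ops_singleton simp del: word_ops.simps)
next
  fix v w x y
  show "ops (map f v) \<subseteq> ops (map f w) \<Longrightarrow> ops (map f (x @ v @ y)) \<subseteq> ops (map f (x @ w @ y))"
    by (simp add: ops_append_mono)
qed auto

lemma rot_eq:
  assumes "i \<in> {1..N}"
  shows "rot N a i \<theta> = rotation (local_op N a {i}) (\<theta> / 2)"
  unfolding rot_def site_pauli_eq[OF assms]
  by (rule rotation_half_angle_mat_exp[OF local_op_carrier local_op_square])

lemma rot2_eq:
  assumes "i \<in> {1..<N}"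
  shows "rot2 N a i \<theta> = rotation (local_op N a {i, i + 1}) (\<theta> / 2)"
  unfolding rot2_def site_pauli_mult_eq[OF assms]
  by (rule rotation_half_angle_mat_exp[OF local_op_carrier local_op_square])

section \<open>Transverse-field gates and their circuits\<close>

locale TF_setup =
  fixes N :: nat and \<alpha> \<beta> \<gamma> :: axis
  assumes axes: "distinct [\<alpha>, \<beta>, \<gamma>]"
begin

definition TF_gates :: "nat \<Rightarrow> complex mat set" where
  "TF_gates i = {U. is_TF_gate N \<alpha> \<beta> \<gamma> i U}"

definition pair_gates :: "nat \<Rightarrow> complex mat set" where
  "pair_gates j = range (rotation (majorana_pair N \<alpha> \<gamma> j))"

sublocale pair: gate_family "2 ^ N" pair_gates
  by unfold_locales (auto simp: pair_gates_def)

lemma triple: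
  assumes "i \<in> {1..<N}"
  shows "involution_triple (2 ^ N) (majorana_pair N \<alpha> \<gamma> (2 * i - 1)) (majorana_pair N \<alpha> \<gamma> (2 * i))
    (majorana_pair N \<alpha> \<gamma> (2 * i + 1))"
  using assms axes by unfold_locales
    (auto intro!: majorana_pair_square majorana_pair_commute majorana_pair_anticommute)

lemma TF_gates_eq:
  assumes "i \<in> {1..<N}"
  shows "TF_gates i = involution_triple.gates (majorana_pair N \<alpha> \<gamma> (2 * i - 1))
    (majorana_pair N \<alpha> \<gamma> (2 * i)) (majorana_pair N \<alpha> \<gamma> (2 * i + 1))"
proof -
  define A where "A = majorana_pair N \<alpha> \<gamma> (2 * i - 1)"
  define B where "B = majorana_pair N \<alpha> \<gamma> (2 * i)"
  define C where "C = majorana_pair N \<alpha> \<gamma> (2 * i + 1)"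
  interpret T: involution_triple "2 ^ N" A B C
    unfolding A_def B_def C_def using assms by (rule triple)
  have ops: "A = local_op N \<gamma> {i}" "B = local_op N \<alpha> {i, i + 1}" "C = local_op N \<gamma> {i + 1}"
    using assms by (auto simp: A_def B_def C_def majorana_pair_def)
  have D: "T.D = local_op N \<beta> {i, i + 1}"
    unfolding T.D_def unfolding ops by (rule local_op_third[OF axes assms, symmetric])
  have rot: "rot N \<gamma> i \<theta> = rotation A (\<theta> / 2)" "rot N \<gamma> (i + 1) \<theta> = rotation C (\<theta> / 2)"
    "rot2 N \<alpha> i \<theta> = rotation B (\<theta> / 2)" "rot2 N \<beta> i \<theta> = rotation T.D (\<theta> / 2)" for \<theta>
    using assms unfolding D unfolding ops by (auto simp: rot_eq rot2_eq)
  have "U \<in> TF_gates i \<longleftrightarrow> U \<in> T.gates" for U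
  proof
    assume "U \<in> TF_gates i"
    then show "U \<in> T.gates"
      unfolding TF_gates_def is_TF_gate_def T.gates_def rot by blast
  next
    assume "U \<in> T.gates"
    then obtain p q s t p' q' where U: "U =
        rotation A p * rotation C q * rotation B s * rotation T.D t * rotation A p' * rotation C q'"
      unfolding T.gates_def by auto
    \<comment> \<open>\<open>rot\<close> and \<open>rot2\<close> rotate by half their angle, so the
      angles are doubled.\<close>
    have "U = rot N \<gamma> i (2 * p) * rot N \<gamma> (i + 1) (2 * q) * rot2 N \<alpha> i (2 * s) *
        rot2 N \<beta> i (2 * t) * rot N \<gamma> i (2 * p') * rot N \<gamma> (i + 1) (2 * q')"
      unfolding rot U by simp
    then show "U \<in> TF_gates i"
      using assms unfolding TF_gates_def is_TF_gate_def mem_Collect_eq by (intro conjI exI) auto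
  qed
  then show ?thesis unfolding A_def B_def C_def by blast
qed

text \<open>Rotations about one involution form a one-parameter group, which gives unit and fusion;
  turnover is the exchange of Euler angles.\<close>

lemma pair_order: "hecke_order (\<lambda>v w. pair.ops v \<subseteq> pair.ops w) (2 * N)"
proof -
  let ?a = "majorana_pair N \<alpha> \<gamma>"
  note carrier = majorana_pair_carrier[of N \<alpha> \<gamma>] and square = majorana_pair_square[of N \<alpha> \<gamma>]
  have "hecke_order (\<lambda>v w. pair.ops (map (\<lambda>i. i) v) \<subseteq> pair.ops (map (\<lambda>i. i) w)) (2 * N)"
  proof (rule pair.hecke_order_ops)
    show "1\<^sub>m (2 ^ N) \<in> pair_gates i" for i
      unfolding pair_gates_def using rotation_zero[OF carrier] by (metis rangeI)
    show "V * U \<in> pair_gates i" if "U \<in> pair_gates i" "V \<in> pair_gates i" for i U V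
      using that rotation_add[OF carrier square] unfolding pair_gates_def by auto
    show "V * U = U * V"
      if "i + 1 < j \<or> j + 1 < i" "U \<in> pair_gates i" "V \<in> pair_gates j" for i j U V
      using that rotation_comm[OF carrier rotation_carrier[OF carrier]
          rotation_comm[OF carrier carrier majorana_pair_commute, symmetric]]
      unfolding pair_gates_def by auto
    show "\<exists>U'\<in>pair_gates j. \<exists>V'\<in>pair_gates i. \<exists>W'\<in>pair_gates j. W * V * U = W' * V' * U'"
      if ij: "i \<in> {1..<2 * N}" "j \<in> {1..<2 * N}" "j = i + 1 \<or> i = j + 1"
        and UVW: "U \<in> pair_gates i" "V \<in> pair_gates j" "W \<in> pair_gates i" for i j U V W
    proof -
      have anti: "?a i * ?a j = - (?a j * ?a i)"
        using ij axes by (intro majorana_pair_anticommute) auto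
      obtain s t u where "W * V * U = rotation (?a i) s * rotation (?a j) t * rotation (?a i) u"
        using UVW unfolding pair_gates_def by auto
      then show ?thesis
        using rotation_euler_exchange[OF carrier square carrier square anti, of s t u]
        unfolding pair_gates_def by (metis rangeI)
    qed
  qed
  then show ?thesis by simp
qed

text \<open>The letters of the block lie in the gate set, which is closed under products.
  Conversely, once \<open>rotation_D_conj\<close> removes \<open>D\<close>, a gate is a product of
  such letters, and \<open>le_block\<close> bounds every such product by the block.\<close>

lemma TF_gates_eq_block:
  assumes i: "i \<in> {1..<N}"
  shows "TF_gates i = pair.ops (block i)"
proof -
  define A where "A = majorana_pair N \<alpha> \<gamma> (2 * i - 1)"
  define B where "B = majorana_pair N \<alpha> \<gamma> (2 * i)"
  define C where "C = majorana_pair N \<alpha> \<gamma> (2 * i + 1)"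
  note defs = A_def B_def C_def
  interpret T: involution_triple "2 ^ N" A B C
    unfolding defs using i by (rule triple)
  interpret H: hecke_order "\<lambda>v w. pair.ops v \<subseteq> pair.ops w" "2 * N"
    by (rule pair_order)
  note TF_eq = TF_gates_eq[OF i, folded defs]
  let ?I = "{2 * i - 1..2 * i + 1}"
  have in_gates: "pair_gates j \<subseteq> T.gates" if "j \<in> ?I" for j
  proof -
    have "j = 2 * i - 1 \<or> j = 2 * i \<or> j = 2 * i + 1" using that by auto
    then have "majorana_pair N \<alpha> \<gamma> j \<in> {A, B, C}" unfolding defs by auto
    then show ?thesis unfolding pair_gates_def using T.rotation_in_gates by blast
  qed
  have "pair.ops w \<subseteq> T.gates" if "set w \<subseteq> ?I" for w
    using that
  proof (induction w)
    case Nil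
    show ?case using T.rotation_in_gates(4) by simp
  next
    case (Cons j w)
    then have "pair_gates j \<subseteq> T.gates" "pair.ops w \<subseteq> T.gates" using in_gates[of j] by auto
    then show ?case using T.gates_mult by auto
  qed
  then have "pair.ops (block i) \<subseteq> TF_gates i"
    unfolding TF_eq using i set_block[of i] by simp
  moreover have "U \<in> pair.ops (block i)" if "U \<in> TF_gates i" for U
  proof -
    \<comment> \<open>Collects the operators of all words in the three letters, so that no explicit
      word for the gate has to be tracked.\<close>
    define S where "S = {U. \<exists>w. set w \<subseteq> ?I \<and> U \<in> pair.ops w}"
    have S_mult: "V * W \<in> S" if "V \<in> S" "W \<in> S" for V W
    proof -
      obtain v w where vw: "set v \<subseteq> ?I" "V \<in> pair.ops v" "set w \<subseteq> ?I" "W \<in> pair.ops w"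
        using \<open>V \<in> S\<close> \<open>W \<in> S\<close> unfolding S_def by blast
      then have "set (w @ v) \<subseteq> ?I" "V * W \<in> pair.ops (w @ v)"
        by (simp_all add: pair.ops_appendI)
      then show ?thesis unfolding S_def by blast
    qed
    have letter: "rotation (majorana_pair N \<alpha> \<gamma> j) t \<in> S" if "j \<in> ?I" for j t
    proof -
      have "rotation (majorana_pair N \<alpha> \<gamma> j) t \<in> pair.ops [j]"
        unfolding pair.ops_singleton pair_gates_def by simp
      moreover have "set [j] \<subseteq> ?I" using that by simp
      ultimately show ?thesis unfolding S_def by blast
    qed
    have letters: "rotation A t \<in> S" "rotation B t \<in> S" "rotation C t \<in> S" for t
      unfolding defs by (rule letter, simp)+
    obtain p q s t p' q' where "U =
        rotation A p * rotation C q * rotation B s * rotation T.D t * rotation A p' * rotation C q'"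
      using \<open>U \<in> TF_gates i\<close> unfolding TF_eq T.gates_def by blast
    then have "U \<in> S" unfolding T.rotation_D_conj by (simp only:) (intro S_mult letters)
    then obtain w where "set w \<subseteq> ?I" "U \<in> pair.ops w" unfolding S_def by blast
    then show ?thesis using H.le_block[of i w] i by auto
  qed
  ultimately show ?thesis by blast
qed

sublocale TF: gate_family "2 ^ N" TF_gates
proof
  show "TF_gates i \<subseteq> carrier_mat (2 ^ N) (2 ^ N)" for i
  proof (cases "i \<in> {1..<N}")
    case True
    then show ?thesis using pair.ops_carrier TF_gates_eq_block by simp
  next
    case False
    \<comment> \<open>The position condition leaves the set empty.\<close>
    then show ?thesis by (auto simp: TF_gates_def is_TF_gate_def)
  qed
qed

text \<open>Expanding each letter into its block turns circuits of gates into circuits of pair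
  rotations, where \<open>hecke_order_blocks\<close> governs inclusion.\<close>

lemma TF_ops_le:
  assumes "set w \<subseteq> {1..<N}"
  shows "TF.ops w \<subseteq> TF.ops (concat (map (\<lambda>k. [N - k..<N]) [1..<N]))"
    and "TF.ops w \<subseteq> TF.ops (brick_word N N)"
proof -
  interpret P: hecke_order "\<lambda>v w. pair.ops v \<subseteq> pair.ops w" "2 * N"
    by (rule pair_order)
  interpret H: hecke_order
    "\<lambda>v w. pair.ops (concat (map block v)) \<subseteq> pair.ops (concat (map block w))" N
    by (rule P.hecke_order_blocks) simp
  have TF: "TF.ops v = pair.ops (concat (map block v))" if "set v \<subseteq> {1..<N}" for v
    using that TF_gates_eq_block by (intro pair.ops_concat) auto
  have "set (H.cascades N) \<subseteq> {1..<N}" unfolding H.cascades_def by auto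
  then show "TF.ops w \<subseteq> TF.ops (concat (map (\<lambda>k. [N - k..<N]) [1..<N]))"
    using H.le_triangle[OF assms] unfolding H.cascades_def by (simp only: TF assms)
  have "set (brick_word N N) \<subseteq> {1..<N}" unfolding brick_word_def by auto
  then show "TF.ops w \<subseteq> TF.ops (brick_word N N)"
    using H.le_trans[OF H.le_triangle[OF assms] H.triangle_le_brick_word] by (simp only: TF assms)
qed

lemma circuit_op_Cons:
  assumes "is_TF_circuit N \<alpha> \<beta> \<gamma> ((i, U) # gs)"
  shows "circuit_op N ((i, U) # gs) = circuit_op N gs * U"
proof -
  have carrier: "V \<in> carrier_mat (2 ^ N) (2 ^ N)" if "is_TF_gate N \<alpha> \<beta> \<gamma> j V" for j V
    using that TF.gate_carrier unfolding TF_gates_def by blast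
  \<comment> \<open>Stated for any accumulator \<open>W\<close>: the fold multiplies only from the
    left, so a right factor splits off.\<close>
  have foldl_mult: "foldl (\<lambda>V (i, U). U * V) (W * U) gs = foldl (\<lambda>V (i, U). U * V) W gs * U"
    if "W \<in> carrier_mat (2 ^ N) (2 ^ N)" "U \<in> carrier_mat (2 ^ N) (2 ^ N)"
      "is_TF_circuit N \<alpha> \<beta> \<gamma> gs" for W U and gs :: circuit
    using that
  proof (induction gs arbitrary: W)
    case (Cons g gs)
    obtain j V where g: "g = (j, V)" by fastforce
    have V: "V \<in> carrier_mat (2 ^ N) (2 ^ N)"
      using Cons.prems carrier[of j V] by (simp add: g is_TF_circuit_def)
    have "is_TF_circuit N \<alpha> \<beta> \<gamma> gs" using Cons.prems by (simp add: is_TF_circuit_def)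
    then have "foldl (\<lambda>V (i, U). U * V) (V * W * U) gs = foldl (\<lambda>V (i, U). U * V) (V * W) gs * U"
      using Cons.prems V by (intro Cons.IH mult_carrier_mat[of _ _ "2 ^ N"])
    moreover have "V * W * U = V * (W * U)"
      using Cons.prems V by (intro assoc_mult_mat)
    ultimately show ?case by (simp add: g)
  qed simp
  have U: "U \<in> carrier_mat (2 ^ N) (2 ^ N)" and gs: "is_TF_circuit N \<alpha> \<beta> \<gamma> gs"
    using assms carrier[of i U] by (simp_all add: is_TF_circuit_def)
  have "circuit_op N ((i, U) # gs) = foldl (\<lambda>V (i, U). U * V) (1\<^sub>m (2 ^ N) * U) gs"
    using left_mult_one_mat[OF U] right_mult_one_mat[OF U] by (simp add: circuit_op_def)
  also have "\<dots> = circuit_op N gs * U"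
    unfolding circuit_op_def by (rule foldl_mult[OF one_carrier_mat U gs])
  finally show ?thesis .
qed

lemma TF_ops_eq: "TF.ops w = {circuit_op N gs | gs. is_TF_circuit N \<alpha> \<beta> \<gamma> gs \<and> map fst gs = w}"
proof (induction w)
  case Nil
  show ?case by (auto simp: circuit_op_def is_TF_circuit_def)
next
  case (Cons i w)
  show ?case
  proof (intro equalityI subsetI)
    fix X assume "X \<in> TF.ops (i # w)"
    then obtain U V where X: "X = V * U" "U \<in> TF_gates i" "V \<in> TF.ops w" by auto
    then obtain gs where gs: "V = circuit_op N gs" "is_TF_circuit N \<alpha> \<beta> \<gamma> gs" "map fst gs = w"
      unfolding Cons by blast
    then have "is_TF_circuit N \<alpha> \<beta> \<gamma> ((i, U) # gs)"
      using X(2) by (simp add: is_TF_circuit_def TF_gates_def)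
    then have "X = circuit_op N ((i, U) # gs) \<and> is_TF_circuit N \<alpha> \<beta> \<gamma> ((i, U) # gs) \<and>
        map fst ((i, U) # gs) = i # w"
      using X(1) gs circuit_op_Cons[of i U gs] by simp
    then show "X \<in> {circuit_op N gs | gs. is_TF_circuit N \<alpha> \<beta> \<gamma> gs \<and> map fst gs = i # w}"
      unfolding mem_Collect_eq by (rule exI[of _ "(i, U) # gs"])
  next
    fix X assume "X \<in> {circuit_op N gs | gs. is_TF_circuit N \<alpha> \<beta> \<gamma> gs \<and> map fst gs = i # w}"
    then obtain U gs where X: "X = circuit_op N ((i, U) # gs)"
      "is_TF_circuit N \<alpha> \<beta> \<gamma> ((i, U) # gs)" "map fst gs = w"
      by (auto simp: map_eq_Cons_conv)
    then have "is_TF_gate N \<alpha> \<beta> \<gamma> i U" "is_TF_circuit N \<alpha> \<beta> \<gamma> gs"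
      by (simp_all add: is_TF_circuit_def)
    then have "U \<in> TF_gates i" "circuit_op N gs \<in> TF.ops w"
      using X(3) unfolding Cons TF_gates_def by blast+
    moreover have "X = circuit_op N gs * U" using X(1) circuit_op_Cons[OF X(2)] by simp
    ultimately show "X \<in> TF.ops (i # w)" unfolding word_ops.simps by blast
  qed
qed

end

section \<open>Layers of the square circuit and the theorem\<close>

text \<open>Cuts a flat circuit whose positions form the brick word back into layers.\<close>

lemma split_concat_map:
  "map f xs = concat yss \<Longrightarrow> \<exists>xss. map (map f) xss = yss \<and> concat xss = xs"
proof (induction yss arbitrary: xs)
  case (Cons ys yss)
  then obtain us vs where "xs = us @ vs" "map f us = ys" "map f vs = concat yss"
    by (auto simp: map_eq_append_conv)
  then show ?case using Cons.IH[of vs] by (metis concat.simps(2) list.simps(9))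
qed simp

lemma length_brick_word: "length (brick_word n n) = n * (n - 1) div 2"
proof -
  have odd: "length (filter odd [1..<n]) = n div 2"
    by (induction n) (auto elim!: evenE oddE)
  have even: "length (filter even [1..<n]) = (n - 1) div 2"
    by (induction n) (auto elim!: evenE oddE)
  \<comment> \<open>The number \<open>m\<close> of layers is independent of \<open>n\<close> for the
    induction; \<open>(m + 1) div 2\<close> of them are odd and \<open>m div 2\<close> are
    even.\<close>
  have "length (brick_word n m) = (m + 1) div 2 * (n div 2) + m div 2 * ((n - 1) div 2)" for m
  proof (induction m)
    case (Suc m)
    have "brick_word n (Suc m) = brick_word n m @ filter (\<lambda>i. odd (i + m)) [1..<n]"
      by (simp add: brick_word_def)
    moreover have "length (filter (\<lambda>i. odd (i + m)) [1..<n]) = (if even m then n div 2 else (n - 1) div 2)"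
      using odd even by simp
    ultimately show ?case using Suc by (auto elim!: evenE oddE)
  qed (simp add: brick_word_def)
  then have len: "length (brick_word n n) = (n + 1) div 2 * (n div 2) + n div 2 * ((n - 1) div 2)" .
  show ?thesis
  proof (cases "even n")
    case True
    then obtain b where n: "n = 2 * b" by (rule evenE)
    show ?thesis unfolding len unfolding n by (cases b) (simp_all add: algebra_simps)
  next
    case False
    then obtain b where "n = 2 * b + 1" by (rule oddE)
    then show ?thesis unfolding len by (simp add: algebra_simps)
  qed
qed

theorem mainTheorem5:
  fixes N n_t :: nat and \<alpha> \<beta> \<gamma> :: axis and Ls :: "circuit list"
  assumes "N \<ge> 2"
    and "distinct [\<alpha>, \<beta>, \<gamma>]"
    and "real n_t > real N / 2"
    and "is_TF_brickwork N \<alpha> \<beta> \<gamma> (2 * n_t) Ls"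
  shows "(\<exists>Ss. is_TF_square N \<alpha> \<beta> \<gamma> Ss \<and>
              length (concat Ss) = N * (N - 1) div 2 \<and>
              circuit_op N (concat Ls) = circuit_op N (concat Ss)) \<and>
         (\<exists>ts. is_TF_triangle N \<alpha> \<beta> \<gamma> ts \<and>
              circuit_op N (concat Ls) = circuit_op N ts)"
proof -
  interpret TF_setup N \<alpha> \<beta> \<gamma> by unfold_locales (rule assms)
  have "is_TF_circuit N \<alpha> \<beta> \<gamma> L" if L: "L \<in> set Ls" for L
  proof -
    obtain k where "k < length Ls" "L = Ls ! k" using L by (metis in_set_conv_nth)
    then show ?thesis using assms(4) by (simp add: is_TF_brickwork_def is_TF_layer_def)
  qed
  then have circuit: "is_TF_circuit N \<alpha> \<beta> \<gamma> (concat Ls)"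
    by (fastforce simp: is_TF_circuit_def)
  then have "circuit_op N (concat Ls) \<in> TF.ops (map fst (concat Ls))"
    unfolding TF_ops_eq by blast
  moreover have "set (map fst (concat Ls)) \<subseteq> {1..<N}"
    using circuit by (fastforce simp: is_TF_circuit_def is_TF_gate_def)
  ultimately have mem: "circuit_op N (concat Ls) \<in> TF.ops (concat (map (\<lambda>k. [N - k..<N]) [1..<N]))"
    "circuit_op N (concat Ls) \<in> TF.ops (brick_word N N)"
    using TF_ops_le by blast+
  obtain ts where ts: "circuit_op N (concat Ls) = circuit_op N ts" "is_TF_circuit N \<alpha> \<beta> \<gamma> ts"
    "map fst ts = concat (map (\<lambda>k. [N - k..<N]) [1..<N])"
    using mem(1) unfolding TF_ops_eq by blast
  obtain ss where ss: "circuit_op N (concat Ls) = circuit_op N ss" "is_TF_circuit N \<alpha> \<beta> \<gamma> ss"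
    "map fst ss = brick_word N N"
    using mem(2) unfolding TF_ops_eq by blast
  obtain Ss where Ss: "map (map fst) Ss = map (\<lambda>k. filter (\<lambda>i. odd (i + k)) [1..<N]) [0..<N]"
    "concat Ss = ss"
    using split_concat_map[OF ss(3)[unfolded brick_word_def]] by blast
  have len: "length Ss = N" using arg_cong[OF Ss(1), of length] by simp
  have "is_TF_layer N \<alpha> \<beta> \<gamma> (if even k then odd else even) (Ss ! k)" if "k < N" for k
  proof -
    have "map fst (Ss ! k) = filter (\<lambda>i. odd (i + k)) [1..<N]"
      using arg_cong[OF Ss(1), of "\<lambda>xs. xs ! k"] that len by simp
    \<comment> \<open>Positions have the parity opposite to the index \<open>k\<close>, since
      indices start at 0.\<close>
    moreover have "set (filter (\<lambda>i. odd (i + k)) [1..<N]) =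
        {i \<in> {1..N - 1}. (if even k then odd else even) i}"
      by auto
    moreover have "Ss ! k \<in> set Ss" using that len by simp
    then have "is_TF_circuit N \<alpha> \<beta> \<gamma> (Ss ! k)"
      using ss(2) unfolding is_TF_circuit_def Ss(2)[symmetric] by auto
    ultimately show ?thesis
      unfolding is_TF_layer_def by (simp only: distinct_filter distinct_upt simp_thms)
  qed
  then have "is_TF_square N \<alpha> \<beta> \<gamma> Ss"
    unfolding is_TF_square_def is_TF_brickwork_def using len by blast
  moreover have "length (concat Ss) = N * (N - 1) div 2"
    using arg_cong[OF ss(3), of length] by (simp add: length_brick_word Ss(2))
  moreover have "is_TF_triangle N \<alpha> \<beta> \<gamma> ts"
    unfolding is_TF_triangle_def using ts(2,3) by (rule conjI)
  ultimately show ?thesis using ts(1) ss(1) unfolding Ss(2)[symmetric] by blast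
qed

end
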